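(* Let $\Omega$ be a domain in $\mathbb{R}^{m+n}$, $m\geq n\geq 2$, and let $K\geq 1$. Let $u:\Omega\rightarrow[-\infty,+\infty)$ be a Lebesgue measurable function. Suppose that the following conditions are satisfied: (a) For each $y\in\mathbb{R}^n$ the function $\Omega(y)\ni x\mapsto u(x,y)\in[-\infty,+\infty)$ is $K$-quasi-nearly subharmonic. (b) For each $x\in\mathbb{R}^m$ the function $\Omega(x)\ni y\mapsto u(x,y)\in[-\infty,+\infty)$ is $K$-quasi-nearly subharmonic. (c) There are increasing functions $\varphi:[0,+\infty)\rightarrow[0,+\infty)$ and $\psi:[0,+\infty)\rightarrow[0,+\infty)$ and $s_0,s_1\in\mathbb{N}$, $s_0<s_1$, such that (c1) the inverse functions $\varphi^{-1}$ and $\psi^{-1}$ are defined on $[\inf\{\varphi(s_1-s_0),\psi(s_1-s_0)\},+\infty)$, (c2) $2K(\psi^{-1}\circ\varphi)(s-s_0)\leq(\psi^{-1}\circ\varphi)(s)$ for all $s\geq s_1$, (c3) the function $[s_1+1,+\infty)\ni s\mapsto\dfrac{(\psi^{-1}\circ\varphi)(s+1)}{(\psi^{-1}\circ\varphi)(s)}\in\mathbb{R}$ is bounded, (c4) $\displaystyle\int_{s_1}^{+\infty}\frac{s^{(n-1)/(m-1)}}{\varphi(s-s_0)^{1/(m-1)}}\,ds<+\infty$, (c5) $\psi\circ u^+\in\mathcal{L}^1_{\mathrm{loc}}(\Omega)$. Then $u$ is quasi-nearly subharmonic in $\Omega$.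
   Context: Points of $\mathbb{R}^{m+n}$ are written $(x,y)$ with $x\in\mathbb{R}^m$, $y\in\mathbb{R}^n$. The sections of $\Omega$ are the open sets $\Omega(y)=\{x\in\mathbb{R}^m:(x,y)\in\Omega\}$ and $\Omega(x)=\{y\in\mathbb{R}^n:(x,y)\in\Omega\}$ (conditions on empty sections are void). $u^+=\max\{u,0\}$. $m_N$ is Lebesgue measure on $\mathbb{R}^N$, $B^N(x,r)$ is the open ball of center $x$ and radius $r>0$, and $\nu_N=m_N(B^N(0,1))$. "Increasing" means nondecreasing (not necessarily strictly). That an inverse function is defined on an interval means that each point of the interval has exactly one preimage. Let $D$ be an open set in $\mathbb{R}^N$, $N\geq 2$. A Lebesgue measurable function $v:D\to[-\infty,+\infty)$ is $K$-quasi-nearly subharmonic ($K\ge 1$ a constant) if $v^+\in\mathcal{L}^1_{\mathrm{loc}}(D)$ and for all closed balls $\overline{B^N(x,r)}\subset D$ and all $M\geq 0$, $$v_M(x)\leq\frac{K}{\nu_N r^N}\int_{B^N(x,r)}v_M(y)\,dm_N(y),\qquad v_M:=\max\{v,-M\}+M.$$ $v$ is quasi-nearly subharmonic if it is $K'$-quasi-nearly subharmonic for some constant $K'\geq 1$. *)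

theory Defs
  imports "HOL-Analysis.Analysis"
begin

definition locally_integrable_on :: "('a::euclidean_space \<Rightarrow> real) \<Rightarrow> 'a set \<Rightarrow> bool"
    (infixr "locally'_integrable'_on" 46) where
  "f locally_integrable_on D \<longleftrightarrow>
     (\<forall>C. compact C \<longrightarrow> C \<subseteq> D \<longrightarrow> f absolutely_integrable_on C)"

text \<open>A function with values in \<open>[-\<infinity>, +\<infinity>)\<close> is an \<^typ>\<open>ereal\<close>-valued function that never takes the
  value \<open>\<infinity>\<close> on its domain. There its positive part and its shifted truncations are real-valued,
  so \<^const>\<open>real_of_ereal\<close> loses no information below.\<close>

definition pos_part :: "('a \<Rightarrow> ereal) \<Rightarrow> 'a \<Rightarrow> real" where
  "pos_part v x = real_of_ereal (max (v x) 0)"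

definition trunc_below :: "real \<Rightarrow> ('a \<Rightarrow> ereal) \<Rightarrow> 'a \<Rightarrow> real" where
  "trunc_below M v x = real_of_ereal (max (v x) (- ereal M) + ereal M)"

text \<open>Both predicates depend only on the values of \<open>v\<close> on \<open>D\<close>, which is meant to be open. They hold
  vacuously if \<open>D\<close> is empty.\<close>

definition K_quasi_nearly_subharmonic ::
    "real \<Rightarrow> 'a::euclidean_space set \<Rightarrow> ('a \<Rightarrow> ereal) \<Rightarrow> bool" where
  "K_quasi_nearly_subharmonic K D v \<longleftrightarrow>
     K \<ge> 1 \<and>
     v \<in> borel_measurable (lebesgue_on D) \<and>
     (\<forall>x\<in>D. v x < \<infinity>) \<and>
     pos_part v locally_integrable_on D \<and>
     (\<forall>x r M. r > 0 \<longrightarrow> cball x r \<subseteq> D \<longrightarrow> M \<ge> 0 \<longrightarrow>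
        trunc_below M v x \<le>
          K / (measure lebesgue (ball (0::'a) 1) * r ^ DIM('a)) *
            (LINT y:ball x r|lebesgue. trunc_below M v y))"

definition quasi_nearly_subharmonic :: "'a::euclidean_space set \<Rightarrow> ('a \<Rightarrow> ereal) \<Rightarrow> bool" where
  "quasi_nearly_subharmonic D v \<longleftrightarrow> (\<exists>K\<ge>1. K_quasi_nearly_subharmonic K D v)"

text \<open>The inverse of a function on \<open>[0, +\<infinity>)\<close>. It is only meaningful at points having exactly one
  preimage in \<open>[0, +\<infinity>)\<close>; \<open>inverse_defined_on f T\<close> says that this holds for all points of \<open>T\<close>.\<close>

definition inverse_defined_on :: "(real \<Rightarrow> real) \<Rightarrow> real set \<Rightarrow> bool" where
  "inverse_defined_on f T \<longleftrightarrow> (\<forall>t\<in>T. \<exists>!s. s \<in> {0..} \<and> f s = t)"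

abbreviation inv_nonneg :: "(real \<Rightarrow> real) \<Rightarrow> real \<Rightarrow> real" where
  "inv_nonneg f \<equiv> inv_into {0..} f"

end

theory Submission
  imports Defs
begin

text \<open>Let \<open>w\<close> be the positive part of \<open>u\<close>. The point is that \<open>w\<close> is locally bounded. Then \<open>w\<close> is
  locally integrable, and the mean value inequality over a ball of radius \<open>r\<close> follows from those in
  the two groups of variables over balls of radius \<open>r / 2\<close>, by Tonelli's theorem
  (\<open>separately_qns_imp_qns\<close>).

  Local boundedness comes from an argument of Domar. Put \<open>a i = (\<psi>\<inverse> \<circ> \<phi>) (s\<^sub>1 + 1 + i)\<close>. By (c2) and
  (c3), \<open>s\<^sub>0\<close> steps multiply the levels \<open>a i\<close> by at least \<open>2 * K\<close>, and a single step multiplies them by a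
  bounded factor. If a \<open>K\<close>-quasi-nearly subharmonic function has a value of at least \<open>a (i + s\<^sub>0)\<close> at a
  point, then every closed ball around the point inside the domain either contains a point at level
  \<open>a (i + s\<^sub>0 + 1)\<close>, or is filled to a fixed proportion by points at level \<open>a i\<close> or above.
  If these level sets were small, this would produce a sequence of points, staying in a fixed ball, along which the function tends to infinity;
  but a quasi-nearly subharmonic function is locally bounded. So a large value at one point forces
  the level sets to be large: for every measurable \<open>g\<close> that is at least \<open>\<tau> i\<close> where the function is at
  level \<open>a i\<close> or above, the integral of \<open>g\<close> has a lower bound in terms of the sum of the
  \<open>\<tau> i powr (- 1 / (d - 1))\<close>, with \<open>d\<close> the dimension (\<open>domar_estimate\<close>).

  This is first applied in \<open>x\<close> for fixed \<open>y\<close>, with \<open>\<tau> i = \<phi> (s\<^sub>1 + 1 + i) = \<psi> (a i)\<close> and \<open>g = \<psi> \<circ> w\<close>. With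
  \<open>S i\<close> the tail sums of \<open>\<phi> (s\<^sub>1 + 1 + i) powr (- 1 / (m - 1))\<close>, it says that a value of at least
  \<open>a (i + s\<^sub>0)\<close> at a single \<open>x\<close> in a ball forces the integral of \<open>\<psi> \<circ> w (\<cdot>, y)\<close> over the concentric ball
  of twice the radius to be at least a constant times \<open>S i powr (- (m - 1))\<close>. As a function of \<open>y\<close>
  this integral is integrable, by (c5). So the estimate can be applied again, in \<open>y\<close> for fixed \<open>x\<close>, and excludes large values
  of \<open>w\<close> uniformly (\<open>separately_qns_bounded_on_product\<close>). The second application needs the
  sum of \<open>S i powr ((m - 1) / (n - 1))\<close> to be finite. By a Hardy-type inequality, which needs the
  exponent to be at least \<open>1\<close>, that is \<open>n \<le> m\<close>, this follows from the convergence of the sum of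
  \<open>(i + 1) powr ((n - 1) / (m - 1)) * \<phi> (s\<^sub>1 + 1 + i) powr (- 1 / (m - 1))\<close>
  (\<open>tail_power_summable\<close>), which is the content of (c4).\<close>

section \<open>Truncations and the mean value inequality\<close>

lemma pos_part_nonneg: "0 \<le> pos_part v x"
  unfolding pos_part_def by (intro real_of_ereal_pos) simp

lemma trunc_below_zero: "trunc_below 0 v = pos_part v"
  by (simp add: trunc_below_def pos_part_def fun_eq_iff zero_ereal_def[symmetric])

lemma trunc_below_nonneg: "0 \<le> trunc_below M v x"
  unfolding trunc_below_def
proof (intro real_of_ereal_pos)
  have "0 = - ereal M + ereal M" by (simp add: zero_ereal_def)
  also have "\<dots> \<le> max (v x) (- ereal M) + ereal M" by (intro add_right_mono) simp
  finally show "0 \<le> max (v x) (- ereal M) + ereal M" .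
qed

lemma trunc_below_le:
  assumes "v x < \<infinity>" "M \<ge> 0"
  shows "trunc_below M v x \<le> pos_part v x + M"
  using assms unfolding trunc_below_def pos_part_def
  by (cases "v x") (auto simp: max_def)

lemma borel_measurable_pos_part:
  "v \<in> borel_measurable N \<Longrightarrow> pos_part v \<in> borel_measurable N"
  unfolding pos_part_def by measurable

lemma borel_measurable_trunc_below:
  "v \<in> borel_measurable N \<Longrightarrow> trunc_below M v \<in> borel_measurable N"
  unfolding trunc_below_def
  by (intro borel_measurable_real_of_ereal borel_measurable_ereal_add borel_measurable_max) simp_all

lemma measure_ball_eq:
  assumes "r \<ge> 0"
  shows "measure lebesgue (ball (x::'a::euclidean_space) r)
           = measure lebesgue (ball (0::'a) 1) * r ^ DIM('a)"
  using content_ball[of r x] content_ball[of 1 "0::'a"] assms by simp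

lemma ennreal_integral_le_nn_integral:
  assumes "\<And>x. f x \<ge> 0"
  shows "ennreal (integral\<^sup>L M f) \<le> (\<integral>\<^sup>+x. ennreal (f x) \<partial>M)"
  by (metis AE_I2 assms ennreal_0 le_zero_eq linorder_linear nn_integral_eq_integral not_integrable_integral_eq)

lemma qns_mean_value:
  fixes v :: "'a::euclidean_space \<Rightarrow> ereal"
  assumes "K_quasi_nearly_subharmonic K D v" "r > 0" "cball x r \<subseteq> D" "M \<ge> 0"
  shows "ennreal (trunc_below M v x) \<le> ennreal (K / (measure lebesgue (ball (0::'a) 1) * r ^ DIM('a))) *
          (\<integral>\<^sup>+y. ennreal (indicator (ball x r) y * trunc_below M v y) \<partial>lebesgue)"
proof -
  define c where "c = K / (measure lebesgue (ball (0::'a) 1) * r ^ DIM('a))"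
  have "K \<ge> 1" using assms unfolding K_quasi_nearly_subharmonic_def by auto
  then have "c \<ge> 0" using assms unfolding c_def by simp
  have "trunc_below M v x \<le> c * (LINT y:ball x r|lebesgue. trunc_below M v y)"
    using assms unfolding K_quasi_nearly_subharmonic_def c_def by blast
  then have "ennreal (trunc_below M v x) \<le> ennreal c * ennreal (LINT y:ball x r|lebesgue. trunc_below M v y)"
    using \<open>c \<ge> 0\<close> by (metis ennreal_leI ennreal_mult')
  also have "\<dots> \<le> ennreal c * (\<integral>\<^sup>+y. ennreal (indicator (ball x r) y * trunc_below M v y) \<partial>lebesgue)"
    unfolding set_lebesgue_integral_def real_scaleR_def
    by (intro mult_left_mono ennreal_integral_le_nn_integral) (auto simp: trunc_below_nonneg)
  finally show ?thesis unfolding c_def .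
qed

section \<open>Domar's argument\<close>

text \<open>An increasing sequence of levels \<open>a i\<close>: climbing \<open>k\<close> steps at least doubles the level (with a spare
  factor \<open>K\<close> that absorbs the constant of the mean value inequality), while a single step multiplies
  it by at most \<open>C\<close>.\<close>

locale growth_scale =
  fixes K C :: real and k :: nat and a :: "nat \<Rightarrow> real"
  assumes K_ge_1: "K \<ge> 1" and C_pos: "C > 0"
    and mono_scale: "mono a" and scale_pos: "\<And>i. a i > 0"
    and doubling: "\<And>i. 2 * K * a i \<le> a (i + k)"
    and ratio_bound: "\<And>i. a (Suc i) \<le> C * a i"
begin

lemma shifted_scale: "growth_scale K C k (\<lambda>i. a (i + j))"
proof
  show "mono (\<lambda>i. a (i + j))" using mono_scale by (auto simp: mono_def)
  show "2 * K * a (i + j) \<le> a (i + k + j)" for i using doubling[of "i + j"] by (simp add: ac_simps)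
qed (use K_ge_1 C_pos scale_pos ratio_bound in auto)

lemma scale_unbounded: "\<exists>i. B < a i"
proof -
  have *: "2 ^ j * a 0 \<le> a (j * k)" for j
  proof (induction j)
    case (Suc j)
    have "2 ^ Suc j * a 0 \<le> 2 * a (j * k)" using Suc by simp
    also have "\<dots> \<le> 2 * K * a (j * k)" using K_ge_1 scale_pos[of "j * k"] by simp
    also have "\<dots> \<le> a (Suc j * k)" using doubling[of "j * k"] by (simp add: ac_simps)
    finally show ?case .
  qed simp
  obtain j where "B / a 0 < 2 ^ j" using real_arch_pow[of 2 "B / a 0"] by auto
  then have "B < 2 ^ j * a 0" using scale_pos[of 0] by (simp add: field_simps)
  then show ?thesis using *[of j] by (intro exI[of _ "j * k"]) simp
qed

text \<open>The band from \<open>a i\<close> to \<open>a (i + k + 1)\<close> consists of \<open>k + 1\<close> consecutive steps of the scale, so bands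
  whose indices differ by more than \<open>k\<close> are disjoint.\<close>

lemma overlap_bound: "card {i \<in> {..<n}. a i \<le> t \<and> t < a (i + k + 1)} \<le> k + 1"
proof (cases "\<exists>i. a i \<le> t \<and> t < a (i + k + 1)")
  case True
  define j where "j = (LEAST i. a i \<le> t \<and> t < a (i + k + 1))"
  have j: "t < a (j + k + 1)" using LeastI_ex[OF True] unfolding j_def by auto
  have "{i \<in> {..<n}. a i \<le> t \<and> t < a (i + k + 1)} \<subseteq> {j..<j + (k + 1)}"
  proof
    fix i assume "i \<in> {i \<in> {..<n}. a i \<le> t \<and> t < a (i + k + 1)}"
    then have i: "a i \<le> t" "t < a (i + k + 1)" by auto
    then have "j \<le> i" unfolding j_def by (intro Least_le) auto
    moreover have "i < j + (k + 1)"
      using j i monoD[OF mono_scale, of "j + k + 1" i] by (cases "i < j + (k + 1)") auto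
    ultimately show "i \<in> {j..<j + (k + 1)}" by auto
  qed
  from card_mono[OF _ this] show ?thesis by simp
next
  case False
  then have empty: "{i \<in> {..<n}. a i \<le> t \<and> t < a (i + k + 1)} = {}" by auto
  show ?thesis unfolding empty by simp
qed

text \<open>Chebyshev's inequality for all bands at once. Summing over the bands costs only the factor
  \<open>k + 1\<close>, because every point lies in at most \<open>k + 1\<close> of them.\<close>

lemma weighted_level_sets:
  fixes w :: "'a::euclidean_space \<Rightarrow> real" and g :: "'a \<Rightarrow> ennreal" and B :: "'a set"
  defines "E \<equiv> \<lambda>i. {y \<in> B. a i \<le> w y \<and> w y < a (i + k + 1)}"
  assumes E: "\<And>i. E i \<in> sets lebesgue"
    and g: "g \<in> borel_measurable lebesgue"
    and dominated: "AE y in lebesgue. y \<in> B \<longrightarrow> (\<forall>i. a i \<le> w y \<longrightarrow> ennreal (\<tau> i) \<le> g y)"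
  shows "(\<Sum>i<n. ennreal (\<tau> i) * emeasure lebesgue (E i)) \<le> ennreal (real (k + 1)) * (\<integral>\<^sup>+y. g y \<partial>lebesgue)"
proof -
  have "(\<Sum>i<n. ennreal (\<tau> i) * emeasure lebesgue (E i))
      = (\<integral>\<^sup>+y. (\<Sum>i<n. ennreal (\<tau> i) * indicator (E i) y) \<partial>lebesgue)"
    using E by (subst nn_integral_sum) (auto simp: nn_integral_cmult_indicator)
  also have "\<dots> \<le> (\<integral>\<^sup>+y. ennreal (real (k + 1)) * g y \<partial>lebesgue)"
  proof (rule nn_integral_mono_AE, use dominated in eventually_elim)
    fix y assume dom: "y \<in> B \<longrightarrow> (\<forall>i. a i \<le> w y \<longrightarrow> ennreal (\<tau> i) \<le> g y)"
    define A where "A = {i \<in> {..<n}. a i \<le> w y \<and> w y < a (i + k + 1)}"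
    have "(\<Sum>i<n. ennreal (\<tau> i) * indicator (E i) y) \<le> (\<Sum>i<n. if i \<in> A then g y else 0)"
      using dom by (intro sum_mono) (auto simp: E_def A_def indicator_def)
    also have "\<dots> = of_nat (card A) * g y"
      by (subst sum.mono_neutral_cong_right[of "{..<n}" A _ "\<lambda>_. g y"]) (auto simp: A_def)
    also have "\<dots> \<le> of_nat (k + 1) * g y"
      using overlap_bound[of n "w y"] unfolding A_def by (intro mult_right_mono of_nat_mono) auto
    finally show "(\<Sum>i<n. ennreal (\<tau> i) * indicator (E i) y) \<le> ennreal (real (k + 1)) * g y"
      by (simp only: ennreal_of_nat_eq_real_of_nat)
  qed
  also have "\<dots> = ennreal (real (k + 1)) * (\<integral>\<^sup>+y. g y \<partial>lebesgue)"
    using g by (rule nn_integral_cmult)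
  finally show ?thesis .
qed

end

text \<open>In the mean value inequality over the ball, the points where \<open>v\<close> stays below \<open>lo\<close> contribute at most
  \<open>K * lo\<close>, hence at most half of the value \<open>t\<close> at the centre. The other half has to come from the set
  where \<open>lo \<le> v\<close>; there \<open>v\<close> is at most \<open>C * t\<close>, so that set fills a fixed fraction of the ball.\<close>

lemma qns_level_set_large:
  fixes v :: "'a::euclidean_space \<Rightarrow> ereal"
  assumes qns: "K_quasi_nearly_subharmonic K D v" and r: "r > 0" "cball x r \<subseteq> D"
    and E: "{y \<in> ball x r. lo \<le> pos_part v y} \<in> sets lebesgue"
    and lo: "0 \<le> lo" "2 * K * lo \<le> t"
    and hi: "\<And>y. y \<in> ball x r \<Longrightarrow> pos_part v y < hi" "hi \<le> C * t"
    and t: "t > 0" "t \<le> pos_part v x"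
  shows "measure lebesgue (ball (0::'a) 1) * r ^ DIM('a)
           \<le> 2 * K * C * measure lebesgue {y \<in> ball x r. lo \<le> pos_part v y}"
proof -
  define E where "E = {y \<in> ball x r. lo \<le> pos_part v y}"
  define V where "V = measure lebesgue (ball (0::'a) 1) * r ^ DIM('a)"
  have "K \<ge> 1" using qns unfolding K_quasi_nearly_subharmonic_def by auto
  have "V > 0" using r unfolding V_def by (simp add: content_ball_pos)
  have "emeasure lebesgue (ball x r) = ennreal (measure lebesgue (ball x r))"
    by (intro emeasure_eq_measure2 lmeasurable_ball)
  then have "emeasure lebesgue (ball x r) = ennreal V"
    using measure_ball_eq[of r x] r unfolding V_def by simp
  note V = \<open>V > 0\<close> this
  have Em: "E \<in> sets lebesgue" using E unfolding E_def .
  have "emeasure lebesgue E \<le> emeasure lebesgue (ball x r)"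
    by (intro emeasure_mono) (auto simp: E_def)
  then have Ee: "emeasure lebesgue E = ennreal (measure lebesgue E)"
    using V by (intro emeasure_eq_ennreal_measure) (auto simp: top_unique)
  have hi0: "0 \<le> hi" using hi(1)[of x] r pos_part_nonneg[of v x] by auto
  have "ennreal t \<le> ennreal (pos_part v x)" using t by (intro ennreal_leI)
  also have "\<dots> \<le> ennreal (K / V) * (\<integral>\<^sup>+y. ennreal (indicator (ball x r) y * pos_part v y) \<partial>lebesgue)"
    using qns_mean_value[OF qns r, of 0] unfolding V_def trunc_below_zero by simp
  also have "\<dots> \<le> ennreal (K / V) *
     (\<integral>\<^sup>+y. ennreal lo * indicator (ball x r) y + ennreal hi * indicator E y \<partial>lebesgue)"
  proof (intro mult_left_mono nn_integral_mono)
    fix y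
    show "ennreal (indicator (ball x r) y * pos_part v y)
       \<le> ennreal lo * indicator (ball x r) y + ennreal hi * indicator E y"
    proof (cases "y \<in> ball x r")
      case True
      have "pos_part v y \<le> lo + hi * indicator E y"
        using True hi(1)[OF True] lo(1) by (auto simp: E_def indicator_def)
      then have "ennreal (pos_part v y) \<le> ennreal (lo + hi * indicator E y)" by (rule ennreal_leI)
      also have "\<dots> = ennreal lo + ennreal hi * indicator E y"
        using lo(1) hi0 by (auto simp: indicator_def)
      finally show ?thesis using True by simp
    qed simp
  qed simp
  also have "\<dots> = ennreal (K / V) * (ennreal lo * ennreal V + ennreal hi * ennreal (measure lebesgue E))"
  proof -
    have B: "ball x r \<in> sets lebesgue" by simp
    have "(\<lambda>y. ennreal lo * indicator (ball x r) y) \<in> borel_measurable lebesgue"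
      "(\<lambda>y. ennreal hi * indicator E y) \<in> borel_measurable lebesgue"
      using B Em by measurable
    then show ?thesis
      by (simp only: nn_integral_add nn_integral_cmult_indicator[OF B]
            nn_integral_cmult_indicator[OF Em] V Ee)
  qed
  also have "\<dots> = ennreal (K / V * (lo * V + hi * measure lebesgue E))"
  proof -
    have "K / V \<ge> 0" "lo * V \<ge> 0" "hi * measure lebesgue E \<ge> 0" "V \<ge> 0"
      using \<open>K \<ge> 1\<close> V lo hi0 by auto
    with lo hi0 show ?thesis
      by (simp only: ennreal_mult ennreal_plus add_nonneg_nonneg measure_nonneg)
  qed
  finally have "t \<le> K / V * (lo * V + hi * measure lebesgue E)"
    using \<open>K \<ge> 1\<close> V lo hi0 by (subst (asm) ennreal_le_iff) (auto intro!: mult_nonneg_nonneg add_nonneg_nonneg)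
  then have "t * V \<le> K * lo * V + K * hi * measure lebesgue E"
    using V by (simp add: field_simps)
  moreover have "2 * (K * lo * V) \<le> t * V"
    using mult_right_mono[OF lo(2), of V] V by (simp add: mult.assoc)
  moreover have "K * hi * measure lebesgue E \<le> K * (C * t) * measure lebesgue E"
    using hi(2) \<open>K \<ge> 1\<close> by (intro mult_right_mono mult_left_mono) auto
  ultimately have "t * V \<le> t * (2 * K * C * measure lebesgue E)" by (simp add: algebra_simps)
  then show ?thesis using t unfolding E_def V_def by simp
qed

text \<open>Every point of \<open>cball x0 R\<close> is the centre of a ball of radius \<open>R\<close> inside \<open>cball x0 (2 * R)\<close>, so one
  integral bounds all the means.\<close>

lemma qns_locally_bounded:
  fixes v :: "'a::euclidean_space \<Rightarrow> ereal"
  assumes qns: "K_quasi_nearly_subharmonic K D v" and R: "R > 0" "cball x0 (2 * R) \<subseteq> D"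
  obtains B where "\<And>x. x \<in> cball x0 R \<Longrightarrow> pos_part v x \<le> B"
proof -
  define c where "c = K / (measure lebesgue (ball (0::'a) 1) * R ^ DIM('a))"
  have "K \<ge> 1" using qns unfolding K_quasi_nearly_subharmonic_def by auto
  then have c: "c \<ge> 0" using R unfolding c_def by simp
  have "pos_part v absolutely_integrable_on cball x0 (2 * R)"
    using qns R unfolding K_quasi_nearly_subharmonic_def locally_integrable_on_def by auto
  then have int: "integrable lebesgue (\<lambda>y. indicator (cball x0 (2 * R)) y * pos_part v y)"
    unfolding set_integrable_def by simp
  define I where "I = (\<integral>y. indicator (cball x0 (2 * R)) y * pos_part v y \<partial>lebesgue)"
  have I: "(\<integral>\<^sup>+y. ennreal (indicator (cball x0 (2 * R)) y * pos_part v y) \<partial>lebesgue) = ennreal I"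
    unfolding I_def using int by (intro nn_integral_eq_integral) (auto simp: pos_part_nonneg)
  have I0: "I \<ge> 0" unfolding I_def by (intro integral_nonneg_AE) (auto simp: pos_part_nonneg)
  have "pos_part v x \<le> c * I" if x: "x \<in> cball x0 R" for x
  proof -
    have sub: "cball x R \<subseteq> cball x0 (2 * R)"
    proof
      fix y assume "y \<in> cball x R"
      then show "y \<in> cball x0 (2 * R)" using x dist_triangle[of x0 y x] by auto
    qed
    have "ennreal (pos_part v x) \<le> ennreal c * (\<integral>\<^sup>+y. ennreal (indicator (ball x R) y * pos_part v y) \<partial>lebesgue)"
      using qns_mean_value[OF qns R(1), of x 0] sub R unfolding c_def trunc_below_zero by auto
    also have "\<dots> \<le> ennreal c * (\<integral>\<^sup>+y. ennreal (indicator (cball x0 (2 * R)) y * pos_part v y) \<partial>lebesgue)"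
    proof -
      have "indicator (ball x R) y \<le> (indicator (cball x0 (2 * R)) y :: real)" for y
        using sub ball_subset_cball[of x R] by (simp add: indicator_def subset_iff)
      then show ?thesis
        by (intro mult_left_mono nn_integral_mono ennreal_leI mult_right_mono)
          (auto simp: pos_part_nonneg simp del: mem_ball mem_cball)
    qed
    also have "\<dots> = ennreal (c * I)" unfolding I using c I0 by (simp add: ennreal_mult)
    finally show ?thesis using c I0 by (subst (asm) ennreal_le_iff) auto
  qed
  with that show thesis by blast
qed

text \<open>Domar's argument, in quantitative form. Suppose the integral of \<open>g\<close> were too small. Starting
  from \<open>x0\<close>, choose points \<open>x 0, x 1, \<dots>\<close> such that \<open>x i\<close> is at level \<open>a (i + k)\<close> or above, and
  \<open>x (i + 1)\<close> has distance less than \<open>\<rho> i\<close> from \<open>x i\<close>. This is possible because otherwise the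
  previous estimate would make the measure of the band starting at level \<open>a i\<close> at least \<open>c * \<rho> i ^ d\<close>, against the
  choice of \<open>\<rho> i\<close>. The radii add up to at most \<open>R / 2\<close>, so the values of \<open>v\<close> would be unbounded on
  \<open>cball x0 (R / 2)\<close>, which contradicts the local boundedness of \<open>v\<close>.\<close>

lemma domar_estimate:
  fixes v :: "'a::euclidean_space \<Rightarrow> ereal" and \<tau> :: "nat \<Rightarrow> real" and g :: "'a \<Rightarrow> ennreal"
  assumes scale: "growth_scale K C k a"
    and qns: "K_quasi_nearly_subharmonic K D v"
    and R: "R > 0" "cball x0 R \<subseteq> D"
    and dim: "DIM('a) \<ge> 2"
    and \<tau>: "\<And>i. \<tau> i > 0"
    and S: "S > 0" "\<And>n. (\<Sum>i<n. \<tau> i powr (- 1 / (real DIM('a) - 1))) \<le> S"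
    and g: "g \<in> borel_measurable lebesgue"
    and dominated: "AE y in lebesgue. y \<in> ball x0 R \<longrightarrow> (\<forall>i. a i \<le> pos_part v y \<longrightarrow> ennreal (\<tau> i) \<le> g y)"
    and large: "a k \<le> pos_part v x0"
  shows "ennreal (measure lebesgue (ball (0::'a) 1) / (2 * K * C) * (R / 4) ^ DIM('a))
           \<le> ennreal (real (k + 1) * S ^ (DIM('a) - 1)) * (\<integral>\<^sup>+y. g y \<partial>lebesgue)"
proof (rule ccontr)
  assume contra: "\<not> ?thesis"
  interpret growth_scale K C k a by (rule scale)
  define d where "d = DIM('a)"
  obtain e where d: "d = Suc e" "e \<ge> 1" using dim unfolding d_def by (cases "DIM('a)") auto
  define w where "w = pos_part v"
  define c where "c = measure lebesgue (ball (0::'a) 1) / (2 * K * C)"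
  have c: "c > 0" unfolding c_def using K_ge_1 C_pos by (simp add: content_ball_pos)
  define J where "J = real (k + 1) * S ^ e"
  have J: "J > 0" using S unfolding J_def by simp
  have contra': "ennreal J * (\<integral>\<^sup>+y. g y \<partial>lebesgue) < ennreal (c * (R / 4) ^ d)"
    using contra d unfolding J_def c_def d_def by (simp add: not_le)
  then have "(\<integral>\<^sup>+y. g y \<partial>lebesgue) < \<infinity>"
    using J by (auto simp: ennreal_mult_eq_top_iff less_top[symmetric])
  then obtain h where h: "h \<ge> 0" "(\<integral>\<^sup>+y. g y \<partial>lebesgue) = ennreal h"
    by (cases "\<integral>\<^sup>+y. g y \<partial>lebesgue") auto
  have small: "J * h < c * (R / 4) ^ d"
    using contra' J h c R by (simp add: ennreal_mult[symmetric] ennreal_less_iff)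

  have w_meas: "w \<in> borel_measurable (lebesgue_on D)"
    using qns borel_measurable_pos_part unfolding w_def K_quasi_nearly_subharmonic_def by blast
  have ball_D: "ball x0 R \<subseteq> D" using R ball_subset_cball by blast
  have level_meas: "{y \<in> B. lo \<le> w y \<and> w y < hi} \<in> sets lebesgue"
      "{y \<in> B. lo \<le> w y} \<in> sets lebesgue"
    if "B \<in> sets lebesgue" "B \<subseteq> D" for B lo hi
  proof -
    have [measurable]: "w \<in> borel_measurable (lebesgue_on B)"
      using measurable_restrict_mono[OF w_meas that(2)] .
    have "{y \<in> space (lebesgue_on B). lo \<le> w y \<and> w y < hi} \<in> sets (lebesgue_on B)"
      "{y \<in> space (lebesgue_on B). lo \<le> w y} \<in> sets (lebesgue_on B)" by measurable
    then show "{y \<in> B. lo \<le> w y \<and> w y < hi} \<in> sets lebesgue" "{y \<in> B. lo \<le> w y} \<in> sets lebesgue"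
      using that by (auto simp: sets_restrict_space_iff)
  qed

  define E where "E = (\<lambda>i. {y \<in> ball x0 R. a i \<le> w y \<and> w y < a (i + k + 1)})"
  define m where "m = (\<lambda>i. measure lebesgue (E i))"
  have E_meas: "E i \<in> sets lebesgue" for i
    unfolding E_def using ball_D by (intro level_meas) auto
  have E_fin: "E i \<in> fmeasurable lebesgue" for i
    by (rule fmeasurableI2[OF lmeasurable_ball[of x0 R] _ E_meas]) (auto simp: E_def)
  have m_sum: "(\<Sum>i<n. \<tau> i * m i) \<le> real (k + 1) * h" for n
  proof -
    have "ennreal (\<Sum>i<n. \<tau> i * m i) = (\<Sum>i<n. ennreal (\<tau> i) * emeasure lebesgue (E i))"
      using \<tau> E_fin by (simp add: m_def emeasure_eq_measure2 sum_ennreal[symmetric] ennreal_mult less_imp_le)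
    also have "\<dots> \<le> ennreal (real (k + 1)) * (\<integral>\<^sup>+y. g y \<partial>lebesgue)"
      using weighted_level_sets[of "ball x0 R" w g \<tau> n] E_meas g dominated unfolding E_def w_def by blast
    also have "\<dots> = ennreal (real (k + 1) * h)" using h by (simp add: ennreal_mult)
    finally show ?thesis using h by (subst (asm) ennreal_le_iff) auto
  qed

  define b where "b = (\<lambda>i. \<tau> i powr (- 1 / real e))"
  have b: "b i > 0" "b i ^ e * \<tau> i = 1" for i
  proof -
    show "b i > 0" using \<tau>[of i] unfolding b_def by simp
    have "b i ^ e = \<tau> i powr (- 1)"
      unfolding b_def using \<tau>[of i] d by (simp add: powr_realpow[symmetric] powr_powr)
    then show "b i ^ e * \<tau> i = 1" using \<tau>[of i] by (simp add: powr_minus)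
  qed
  \<comment> \<open>The radius \<open>\<rho> i\<close> is a sum of two parts. By the bound \<open>S\<close> the parts \<open>\<alpha> * b i\<close> add up to at
    most \<open>R / 4\<close>, and by the smallness of the integral of \<open>g\<close> so do the parts \<open>\<beta> * (\<tau> i * m i)\<close>. Since
    \<open>b i ^ e * \<tau> i = 1\<close>, one factor of the second kind and \<open>e = d - 1\<close> factors of the first kind
    multiply to exactly \<open>m i / c\<close>; this makes \<open>c * \<rho> i ^ d\<close> larger than \<open>m i\<close>. An optimal choice
    of radii would use Hoelder's inequality and gain only a constant.\<close>
  define \<alpha> where "\<alpha> = R / (4 * S)"
  define \<beta> where "\<beta> = 1 / (c * \<alpha> ^ e)"
  have \<alpha>: "\<alpha> > 0" using R S unfolding \<alpha>_def by simp
  have \<beta>: "\<beta> > 0" using c \<alpha> unfolding \<beta>_def by simp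
  define \<rho> where "\<rho> = (\<lambda>i. \<alpha> * b i + \<beta> * (\<tau> i * m i))"
  have m_nonneg: "m i \<ge> 0" for i unfolding m_def by simp
  have \<rho>: "\<rho> i > 0" for i
    using \<alpha> \<beta> b(1)[of i] \<tau>[of i] m_nonneg[of i] unfolding \<rho>_def by (intro add_pos_nonneg) auto
  have \<rho>_sum: "(\<Sum>i<n. \<rho> i) \<le> R / 2" for n
  proof -
    have "(\<Sum>i<n. \<rho> i) = \<alpha> * (\<Sum>i<n. b i) + \<beta> * (\<Sum>i<n. \<tau> i * m i)"
      unfolding \<rho>_def by (simp add: sum.distrib sum_distrib_left)
    also have "\<dots> \<le> \<alpha> * S + \<beta> * (real (k + 1) * h)"
    proof -
      have "(\<Sum>i<n. b i) \<le> S" using S(2)[of n] d unfolding b_def d_def by simp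
      then show ?thesis using m_sum[of n] \<alpha> \<beta> by (intro add_mono mult_left_mono) auto
    qed
    also have "\<alpha> * S = R / 4" using S unfolding \<alpha>_def by simp
    also have "\<beta> * (real (k + 1) * h) \<le> R / 4"
    proof -
      have "real (k + 1) * h * S ^ e < c * (R / 4) ^ e * (R / 4)"
        using small unfolding J_def d by (simp add: algebra_simps)
      then have "real (k + 1) * h < c * (R / 4) ^ e / S ^ e * (R / 4)"
        using S by (simp add: field_simps)
      also have "c * (R / 4) ^ e / S ^ e = c * \<alpha> ^ e"
        unfolding \<alpha>_def by (simp add: power_divide power_mult_distrib)
      finally show ?thesis using c \<alpha> unfolding \<beta>_def by (simp add: field_simps)
    qed
    finally show ?thesis by simp
  qed
  have \<rho>_big: "m i < c * \<rho> i ^ d" for i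
  proof -
    have "m i = m i * (b i ^ e * \<tau> i) * (c * \<alpha> ^ e * \<beta>)"
      using b(2)[of i] c \<alpha> unfolding \<beta>_def by simp
    also have "\<dots> = c * ((\<alpha> * b i) ^ e * (\<beta> * (\<tau> i * m i)))"
      by (simp add: power_mult_distrib algebra_simps)
    also have "\<dots> < c * ((\<alpha> * b i) ^ e * \<rho> i)"
      using c \<alpha> b(1)[of i] unfolding \<rho>_def by (intro mult_strict_left_mono) auto
    also have "\<dots> \<le> c * (\<rho> i ^ e * \<rho> i)"
      using c \<alpha> \<beta> b(1)[of i] \<tau>[of i] m_nonneg[of i] \<rho>[of i] unfolding \<rho>_def
      by (intro mult_left_mono mult_right_mono power_mono) auto
    finally show ?thesis using d by (simp add: mult.commute)
  qed

  have chain: "\<exists>x. dist x0 x \<le> (\<Sum>l<i. \<rho> l) \<and> a (i + k) \<le> w x" for i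
  proof (induction i)
    case 0
    show ?case using large unfolding w_def by (intro exI[of _ x0]) auto
  next
    case (Suc i)
    then obtain x where x: "dist x0 x \<le> (\<Sum>l<i. \<rho> l)" "a (i + k) \<le> w x" by auto
    have near: "dist x0 y \<le> (\<Sum>l<Suc i. \<rho> l)" if "dist x y \<le> \<rho> i" for y
      using that x(1) dist_triangle[of x0 y x] by simp
    have sub: "cball x (\<rho> i) \<subseteq> ball x0 R"
      using near \<rho>_sum[of "Suc i"] R by fastforce
    have "\<exists>y\<in>ball x (\<rho> i). a (Suc i + k) \<le> w y"
    proof (rule ccontr)
      assume "\<not> ?thesis"
      then have below: "w y < a (Suc i + k)" if "y \<in> ball x (\<rho> i)" for y
        using that by (meson not_le)
      have "measure lebesgue (ball (0::'a) 1) * \<rho> i ^ DIM('a)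
           \<le> 2 * K * C * measure lebesgue {y \<in> ball x (\<rho> i). a i \<le> w y}"
        unfolding w_def
      proof (rule qns_level_set_large[OF qns \<rho>])
        show "cball x (\<rho> i) \<subseteq> D" using sub ball_D by blast
        show "{y \<in> ball x (\<rho> i). a i \<le> pos_part v y} \<in> sets lebesgue"
          using \<open>cball x (\<rho> i) \<subseteq> D\<close> ball_subset_cball[of x "\<rho> i"]
          by (intro level_meas(2)[unfolded w_def]) auto
        show "0 \<le> a i" "a (i + k) > 0" using scale_pos less_imp_le by blast+
        show "2 * K * a i \<le> a (i + k)" by (rule doubling)
        show "a (Suc i + k) \<le> C * a (i + k)" using ratio_bound[of "i + k"] by simp
        show "pos_part v y < a (Suc i + k)" if "y \<in> ball x (\<rho> i)" for y
          using below[OF that] unfolding w_def .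
        show "a (i + k) \<le> pos_part v x" using x(2) unfolding w_def .
      qed
      also have "\<dots> \<le> 2 * K * C * m i"
      proof -
        have "{y \<in> ball x (\<rho> i). a i \<le> w y} \<subseteq> E i"
          using below sub ball_subset_cball[of x "\<rho> i"] unfolding E_def by fastforce
        moreover have "{y \<in> ball x (\<rho> i). a i \<le> w y} \<in> sets lebesgue"
        proof (rule level_meas(2))
          show "ball x (\<rho> i) \<subseteq> D" using sub ball_D ball_subset_cball[of x "\<rho> i"] by blast
        qed simp
        ultimately have "measure lebesgue {y \<in> ball x (\<rho> i). a i \<le> w y} \<le> m i"
          unfolding m_def using E_fin by (intro measure_mono_fmeasurable) auto
        then show ?thesis using K_ge_1 C_pos by (intro mult_left_mono) auto
      qed
      finally have "c * \<rho> i ^ d \<le> m i"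
        using K_ge_1 C_pos unfolding c_def d_def by (simp add: field_simps)
      with \<rho>_big[of i] show False by simp
    qed
    then obtain y where "dist x y < \<rho> i" "a (Suc i + k) \<le> w y" by auto
    with near[of y] show ?case by (intro exI[of _ y]) auto
  qed
  obtain B where B: "\<And>x. x \<in> cball x0 (R / 2) \<Longrightarrow> pos_part v x \<le> B"
    using qns_locally_bounded[OF qns, of "R / 2" x0] R by auto
  obtain i where i: "B < a i" using scale_unbounded by blast
  obtain x where x: "dist x0 x \<le> (\<Sum>l<i. \<rho> l)" "a (i + k) \<le> w x" using chain by blast
  have "a i \<le> a (i + k)" using mono_scale by (simp add: monoD)
  with x i B[of x] \<rho>_sum[of i] show False unfolding w_def by auto
qed

section \<open>Powers of tail sums\<close>

text \<open>Concavity of \<open>x \<mapsto> x powr \<theta>\<close>, obtained from the weighted inequality between the arithmetic and the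
  geometric mean of \<open>j\<close> and \<open>j + 1\<close>.\<close>

lemma power_increment_ge:
  assumes "0 < \<theta>" "\<theta> \<le> 1"
  shows "\<theta> * real (Suc j) powr (\<theta> - 1) \<le> real (Suc j) powr \<theta> - real j powr \<theta>"
proof (cases "j = 0")
  case False
  have "real j powr \<theta> * real (Suc j) powr (1 - \<theta>) \<le> \<theta> * real j + (1 - \<theta>) * real (Suc j)"
    using False assms by (intro Youngs_inequality_0) auto
  also have "\<dots> = real (Suc j) - \<theta>" by (simp add: algebra_simps)
  finally have "real j powr \<theta> * (real (Suc j) powr (1 - \<theta>) * real (Suc j) powr (\<theta> - 1))
       \<le> (real (Suc j) - \<theta>) * real (Suc j) powr (\<theta> - 1)"
    unfolding mult.assoc[symmetric] by (intro mult_right_mono) auto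
  moreover have "real (Suc j) powr (1 - \<theta>) * real (Suc j) powr (\<theta> - 1) = 1"
    by (simp add: powr_add[symmetric])
  moreover have "real (Suc j) * real (Suc j) powr (\<theta> - 1) = real (Suc j) powr \<theta>"
    by (simp add: powr_mult_base)
  ultimately show ?thesis by (simp add: algebra_simps)
qed (use assms in simp)

text \<open>A Hardy-type inequality. With \<open>W\<close> the weighted sum and \<open>S j\<close> the tails of \<open>b\<close>, clearly
  \<open>(j + 1) powr \<theta> * S j \<le> W\<close>. Inserting this into all but one factor of \<open>S j powr (1 / \<theta>)\<close> leaves
  \<open>S j * (j + 1) powr (\<theta> - 1)\<close>, that is, essentially \<open>S j\<close> times the increment of \<open>j powr \<theta>\<close>. Summation
  by parts turns the sum of these terms back into the weighted sum of \<open>b\<close>. The condition \<open>\<theta> \<le> 1\<close>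
  makes the exponent \<open>1 / \<theta> - 1\<close> of the estimated factor nonnegative.\<close>

lemma tail_power_summable:
  fixes b :: "nat \<Rightarrow> real"
  assumes \<theta>: "0 < \<theta>" "\<theta> \<le> 1" and b: "\<And>i. 0 < b i"
    and W: "summable (\<lambda>i. real (Suc i) powr \<theta> * b i)"
  shows "summable b" and "summable (\<lambda>j. (\<Sum>i. b (i + j)) powr (1 / \<theta>))"
proof -
  define W where "W = (\<Sum>i. real (Suc i) powr \<theta> * b i)"
  have weight_ge_1: "1 \<le> real (Suc i) powr \<theta>" for i
    using \<theta> by (simp add: ge_one_powr_ge_zero)
  show sb: "summable b"
  proof (rule summable_comparison_test'[OF W])
    fix i show "norm (b i) \<le> real (Suc i) powr \<theta> * b i"
      using b[of i] mult_right_mono[OF weight_ge_1[of i], of "b i"] by simp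
  qed
  define S where "S = (\<lambda>j. \<Sum>i. b (i + j))"
  have sb': "summable (\<lambda>i. b (i + j))" for j using sb by (rule summable_ignore_initial_segment)
  have S_nonneg: "S j \<ge> 0" for j unfolding S_def using b less_imp_le by (intro suminf_nonneg sb') blast
  have S_Suc: "S j = b j + S (Suc j)" for j
    unfolding S_def using suminf_split_head[OF sb'[of j]] by simp
  have S_bound: "real (Suc j) powr \<theta> * S j \<le> W" for j
  proof -
    have "real (Suc j) powr \<theta> * S j = (\<Sum>i. real (Suc j) powr \<theta> * b (i + j))"
      unfolding S_def by (rule suminf_mult[OF sb', symmetric])
    also have "\<dots> \<le> (\<Sum>i. real (Suc (i + j)) powr \<theta> * b (i + j))"
      using \<theta> b less_imp_le
      by (intro suminf_le mult_right_mono powr_mono2 summable_mult sb'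
           summable_ignore_initial_segment[OF W]) auto
    also have "\<dots> \<le> W"
    proof -
      have "W = (\<Sum>i. real (Suc (i + j)) powr \<theta> * b (i + j)) + (\<Sum>i<j. real (Suc i) powr \<theta> * b i)"
        unfolding W_def by (rule suminf_split_initial_segment[OF W])
      moreover have "(\<Sum>i<j. real (Suc i) powr \<theta> * b i) \<ge> 0"
        using b less_imp_le by (intro sum_nonneg mult_nonneg_nonneg) auto
      ultimately show ?thesis by simp
    qed
    finally show ?thesis .
  qed
  have W_nonneg: "W \<ge> 0" using S_bound[of 0] S_nonneg[of 0] by simp
  have abel: "(\<Sum>j<n. S j * (real (Suc j) powr \<theta> - real j powr \<theta>))
      = S n * real n powr \<theta> + (\<Sum>j<n. b j * real (Suc j) powr \<theta>)" for n
  proof (induction n)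
    case (Suc n)
    then show ?case using S_Suc[of n] by (simp add: algebra_simps)
  qed (use \<theta> in simp)
  have abel_bound: "(\<Sum>j<n. S j * (real (Suc j) powr \<theta> - real j powr \<theta>)) \<le> 2 * W" for n
  proof -
    have "S n * real n powr \<theta> \<le> S n * real (Suc n) powr \<theta>"
      using \<theta> S_nonneg by (intro mult_left_mono powr_mono2) auto
    also have "\<dots> \<le> W" using S_bound[of n] by (simp add: mult.commute)
    finally have "S n * real n powr \<theta> \<le> W" .
    moreover have "(\<Sum>j<n. b j * real (Suc j) powr \<theta>) \<le> W"
      unfolding W_def mult.commute[of "b _"] using b less_imp_le
      by (intro sum_le_suminf W) (auto intro!: mult_nonneg_nonneg)
    ultimately show ?thesis unfolding abel by simp
  qed
  have summand: "S j powr (1 / \<theta>)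
      \<le> W powr (1 / \<theta> - 1) / \<theta> * (S j * (real (Suc j) powr \<theta> - real j powr \<theta>))" for j
  proof -
    have "S j \<le> W * real (Suc j) powr (- \<theta>)"
      using S_bound[of j] by (simp add: powr_minus field_simps)
    then have "S j powr (1 / \<theta> - 1) \<le> (W * real (Suc j) powr (- \<theta>)) powr (1 / \<theta> - 1)"
      using \<theta> S_nonneg[of j] by (intro powr_mono2) (auto simp: field_simps)
    also have "\<dots> = W powr (1 / \<theta> - 1) * real (Suc j) powr (\<theta> - 1)"
    proof -
      have "- \<theta> * (1 / \<theta> - 1) = \<theta> - 1" using \<theta> by (simp add: field_simps)
      then show ?thesis using W_nonneg by (simp only: powr_mult powr_powr of_nat_0_le_iff powr_ge_zero)
    qed
    finally have "S j * S j powr (1 / \<theta> - 1) \<le> S j * (W powr (1 / \<theta> - 1) * real (Suc j) powr (\<theta> - 1))"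
      using S_nonneg by (intro mult_left_mono)
    also have "\<dots> = W powr (1 / \<theta> - 1) / \<theta> * (S j * (\<theta> * real (Suc j) powr (\<theta> - 1)))"
      using \<theta> by (simp add: field_simps)
    also have "\<dots> \<le> W powr (1 / \<theta> - 1) / \<theta> * (S j * (real (Suc j) powr \<theta> - real j powr \<theta>))"
      using \<theta> S_nonneg by (intro mult_left_mono power_increment_ge) auto
    also have "S j * S j powr (1 / \<theta> - 1) = S j powr (1 / \<theta>)"
      using S_nonneg[of j] by (simp add: powr_mult_base)
    finally show ?thesis .
  qed
  have "summable (\<lambda>j. W powr (1 / \<theta> - 1) / \<theta> * (S j * (real (Suc j) powr \<theta> - real j powr \<theta>)))"
  proof (intro summable_mult bounded_imp_summable)
    show "0 \<le> S j * (real (Suc j) powr \<theta> - real j powr \<theta>)" for j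
      using S_nonneg \<theta> by (intro mult_nonneg_nonneg) (auto intro!: powr_mono2)
    show "(\<Sum>j\<le>n. S j * (real (Suc j) powr \<theta> - real j powr \<theta>)) \<le> 2 * W" for n
      using abel_bound[of "Suc n"] by (simp only: lessThan_Suc_atMost)
  qed
  then have "summable (\<lambda>j. S j powr (1 / \<theta>))"
    by (rule summable_comparison_test') (use summand in auto)
  then show "summable (\<lambda>j. (\<Sum>i. b (i + j)) powr (1 / \<theta>))" unfolding S_def .
qed

section \<open>Sections of Lebesgue measurable functions\<close>

text \<open>Some sections of a Lebesgue measurable function on a product may fail to be measurable. But the
  function agrees almost everywhere with a Borel function \<open>h\<close>, to which Tonelli's theorem applies,
  and almost every section of \<open>h\<close> agrees almost everywhere with that of \<open>f\<close>.\<close>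

lemma lebesgue_Tonelli:
  fixes f :: "'a::euclidean_space \<times> 'b::euclidean_space \<Rightarrow> ennreal"
  assumes f: "f \<in> borel_measurable lebesgue"
  obtains h where "h \<in> borel_measurable borel"
    and "AE x in lebesgue. AE y in lebesgue. f (x, y) = h (x, y)"
    and "AE y in lebesgue. AE x in lebesgue. f (x, y) = h (x, y)"
    and "(\<integral>\<^sup>+z. f z \<partial>lebesgue) = (\<integral>\<^sup>+x. (\<integral>\<^sup>+y. h (x, y) \<partial>lebesgue) \<partial>lebesgue)"
    and "(\<integral>\<^sup>+z. f z \<partial>lebesgue) = (\<integral>\<^sup>+y. (\<integral>\<^sup>+x. h (x, y) \<partial>lebesgue) \<partial>lebesgue)"
proof -
  obtain h where h: "h \<in> borel_measurable lborel" "AE z in lborel. f z = h z"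
    using completion_ex_borel_measurable[OF f] by blast
  have hp: "h \<in> borel_measurable (lborel \<Otimes>\<^sub>M lborel)" using h(1) unfolding lborel_prod .
  obtain N where N: "N \<in> null_sets lborel" "{z. f z \<noteq> h z} \<subseteq> N"
    using h(2) by (auto elim: AE_E simp: null_sets_def)
  have Np: "N \<in> sets (lborel \<Otimes>\<^sub>M lborel)" "AE z in lborel \<Otimes>\<^sub>M lborel. z \<notin> N"
    using N(1) unfolding lborel_prod by (auto intro: AE_not_in)
  have 1: "AE x in lborel. AE y in lborel. (x, y) \<notin> N"
    using lborel_pair.AE_pair[OF Np(2)] .
  have "{z \<in> space (lborel \<Otimes>\<^sub>M lborel). (fst z, snd z) \<notin> N} \<in> sets (lborel \<Otimes>\<^sub>M lborel)"
  proof -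
    have "{z \<in> space (lborel \<Otimes>\<^sub>M lborel). (fst z, snd z) \<notin> N} = space (lborel \<Otimes>\<^sub>M lborel) - N"
      by auto
    then show ?thesis using Np(1) by (simp only: sets.compl_sets)
  qed
  then have 2: "AE y in lborel. AE x in lborel. (x, y) \<notin> N"
    using lborel_pair.AE_commute[of "\<lambda>x y. (x, y) \<notin> N"] 1 by simp
  have integral: "(\<integral>\<^sup>+z. f z \<partial>lebesgue) = (\<integral>\<^sup>+z. h z \<partial>(lborel \<Otimes>\<^sub>M lborel))"
    unfolding nn_integral_completion lborel_prod using h(2) by (rule nn_integral_cong_AE)
  show thesis
  proof
    show "h \<in> borel_measurable borel" using h(1) by simp
    show "AE x in lebesgue. AE y in lebesgue. f (x, y) = h (x, y)"
      unfolding AE_completion_iff using 1 by eventually_elim (use N(2) in \<open>auto elim!: eventually_mono\<close>)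
    show "AE y in lebesgue. AE x in lebesgue. f (x, y) = h (x, y)"
      unfolding AE_completion_iff using 2 by eventually_elim (use N(2) in \<open>auto elim!: eventually_mono\<close>)
    show "(\<integral>\<^sup>+z. f z \<partial>lebesgue) = (\<integral>\<^sup>+x. (\<integral>\<^sup>+y. h (x, y) \<partial>lebesgue) \<partial>lebesgue)"
      using integral lborel.nn_integral_fst[OF hp] by (simp add: nn_integral_completion)
    show "(\<integral>\<^sup>+z. f z \<partial>lebesgue) = (\<integral>\<^sup>+y. (\<integral>\<^sup>+x. h (x, y) \<partial>lebesgue) \<partial>lebesgue)"
      using integral lborel_pair.nn_integral_snd[OF hp] by (simp add: nn_integral_completion)
  qed
qed

section \<open>Boundedness of separately quasi-nearly subharmonic functions\<close>

lemma ennreal_le_multD: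
  assumes "ennreal c \<le> ennreal q * G" "q > 0"
  shows "ennreal (c / q) \<le> G"
proof (cases G)
  case (real r)
  then have "c \<le> q * r" using assms by (simp add: ennreal_mult[symmetric] ennreal_le_iff)
  then show ?thesis using real assms by (simp add: ennreal_le_iff field_simps)
qed auto

text \<open>Domar's estimate is used in each group of variables. For fixed \<open>y\<close> it is applied in the variable
  \<open>x\<close>, with the weights \<open>\<psi> (a i)\<close> and with \<open>\<psi> \<circ> w\<close> as the dominating function: if \<open>w x y\<close> reaches level
  \<open>a (i + k)\<close> at a single \<open>x\<close>, then the integral \<open>g y\<close> of \<open>\<psi> \<circ> w\<close> over the section at \<open>y\<close> is at least
  \<open>\<sigma> i\<close>. This bound no longer mentions \<open>x\<close>. So for fixed \<open>x\<close> the estimate can be applied in the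
  variable \<open>y\<close>, now with the weights \<open>\<sigma> i\<close> and with \<open>g\<close> as the dominating function; it excludes all
  sufficiently high levels, uniformly in \<open>x\<close> and \<open>y\<close>.\<close>

lemma separately_qns_bounded_on_product:
  fixes u :: "'a::euclidean_space \<times> 'b::euclidean_space \<Rightarrow> ereal" and \<psi> :: "real \<Rightarrow> real"
  assumes scale: "growth_scale K C k a"
    and dims: "2 \<le> DIM('b)" "DIM('b) \<le> DIM('a)"
    and R: "R > 0" "cball p (2 * R) \<times> cball q (2 * R) \<subseteq> \<Omega>"
    and qns1: "\<And>y. K_quasi_nearly_subharmonic K {x. (x, y) \<in> \<Omega>} (\<lambda>x. u (x, y))"
    and qns2: "\<And>x. K_quasi_nearly_subharmonic K {y. (x, y) \<in> \<Omega>} (\<lambda>y. u (x, y))"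
    and \<psi>: "mono_on {0..} \<psi>" "\<And>i. \<psi> (a i) > 0" "\<And>t. t \<ge> 0 \<Longrightarrow> \<psi> t \<ge> 0"
    and integrable: "(\<psi> \<circ> pos_part u) absolutely_integrable_on cball p (2 * R) \<times> cball q (2 * R)"
    and weights: "summable (\<lambda>i. real (Suc i) powr ((real DIM('b) - 1) / (real DIM('a) - 1))
                    * \<psi> (a i) powr (- 1 / (real DIM('a) - 1)))"
  shows "\<exists>B. \<forall>x\<in>cball p R. \<forall>y\<in>cball q R. pos_part u (x, y) \<le> B"
proof -
  interpret growth_scale K C k a by (rule scale)
  define Q where "Q = cball p (2 * R) \<times> cball q (2 * R)"
  define w where "w = (\<lambda>x y. pos_part u (x, y))"
  have w1: "pos_part (\<lambda>x. u (x, y)) x = w x y" and w2: "pos_part (\<lambda>y. u (x, y)) y = w x y" for x y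
    unfolding w_def pos_part_def by simp_all
  have w_nonneg: "w x y \<ge> 0" for x y unfolding w_def by (rule pos_part_nonneg)

  define f where "f = (\<lambda>z. ennreal (indicator Q z * \<psi> (pos_part u z)))"
  have int: "integrable lebesgue (\<lambda>z. indicator Q z * \<psi> (pos_part u z))"
    using integrable unfolding Q_def set_integrable_def by simp
  have f_meas: "f \<in> borel_measurable lebesgue"
    unfolding f_def using borel_measurable_integrable[OF int] by measurable
  define H where "H = (\<integral>z. indicator Q z * \<psi> (pos_part u z) \<partial>lebesgue)"
  have H: "(\<integral>\<^sup>+z. f z \<partial>lebesgue) = ennreal H" "H \<ge> 0"
  proof -
    have "indicator Q z * \<psi> (pos_part u z) \<ge> 0" for z
      by (intro mult_nonneg_nonneg \<psi>(3) pos_part_nonneg) simp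
    then show "(\<integral>\<^sup>+z. f z \<partial>lebesgue) = ennreal H" "H \<ge> 0"
      unfolding H_def f_def using int by (auto intro!: nn_integral_eq_integral)
  qed
  obtain h where h: "h \<in> borel_measurable borel"
    "AE y in lebesgue. AE x in lebesgue. f (x, y) = h (x, y)"
    "(\<integral>\<^sup>+z. f z \<partial>lebesgue) = (\<integral>\<^sup>+y. (\<integral>\<^sup>+x. h (x, y) \<partial>lebesgue) \<partial>lebesgue)"
    using lebesgue_Tonelli[OF f_meas] by blast
  define g where "g = (\<lambda>y. \<integral>\<^sup>+x. h (x, y) \<partial>lebesgue)"
  have g_int: "(\<integral>\<^sup>+y. g y \<partial>lebesgue) = ennreal H" using h(3) H(1) unfolding g_def by simp
  have h_section: "(\<lambda>x. h (x, y)) \<in> borel_measurable lebesgue" for y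
  proof -
    have "(\<lambda>x. (x, y)) \<in> borel \<rightarrow>\<^sub>M borel"
      by (intro borel_measurable_continuous_onI continuous_intros)
    then have "(\<lambda>x. h (x, y)) \<in> borel_measurable borel" using h(1) by (rule measurable_compose)
    then show ?thesis by (intro measurable_completion) simp
  qed
  have g_meas: "g \<in> borel_measurable lebesgue"
  proof -
    have "h \<in> borel_measurable (lborel \<Otimes>\<^sub>M lborel)" using h(1) unfolding lborel_prod by simp
    then have "(\<lambda>(y, x). h (x, y)) \<in> borel_measurable (lborel \<Otimes>\<^sub>M lborel)"
      by (rule measurable_pair_swap)
    then have "(\<lambda>y. \<integral>\<^sup>+x. h (x, y) \<partial>lborel) \<in> borel_measurable lborel"
      using lborel.borel_measurable_nn_integral_fst by fastforce
    then show ?thesis unfolding g_def nn_integral_completion by (rule measurable_completion)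
  qed

  define M N where "M = DIM('a)" and "N = DIM('b)"
  have MN: "2 \<le> N" "N \<le> M" using dims unfolding M_def N_def by auto
  define \<theta> where "\<theta> = (real N - 1) / (real M - 1)"
  have \<theta>: "0 < \<theta>" "\<theta> \<le> 1" using MN unfolding \<theta>_def by auto
  define \<tau> where "\<tau> = (\<lambda>i. \<psi> (a i))"
  define b where "b = (\<lambda>i. \<tau> i powr (- 1 / (real M - 1)))"
  have \<tau>: "\<tau> i > 0" for i using \<psi>(2) unfolding \<tau>_def .
  have b: "b i > 0" for i using \<tau>[of i] unfolding b_def by simp
  have weights': "summable (\<lambda>i. real (Suc i) powr \<theta> * b i)"
    using weights unfolding \<theta>_def b_def \<tau>_def M_def N_def .
  define S where "S = (\<lambda>j. \<Sum>i. b (i + j))"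
  have sb: "summable b" and sS: "summable (\<lambda>j. S j powr (1 / \<theta>))"
    using tail_power_summable[OF \<theta> b weights'] unfolding S_def by auto
  have sb': "summable (\<lambda>i. b (i + j))" for j using sb by (rule summable_ignore_initial_segment)
  have S: "S j > 0" for j unfolding S_def using b by (intro suminf_pos sb') auto
  have S_sum: "(\<Sum>i<n. b (i + j)) \<le> S j" for n j
    unfolding S_def using b less_imp_le by (intro sum_le_suminf sb') auto

  define c where "c = measure lebesgue (ball (0::'a) 1) / (2 * K * C) * (R / 4) ^ M"
  have c: "c > 0" unfolding c_def using K_ge_1 C_pos R by (simp add: content_ball_pos)
  define \<sigma> where "\<sigma> = (\<lambda>i. c / (real (k + 1) * S i ^ (M - 1)))"
  have \<sigma>: "\<sigma> i > 0" for i unfolding \<sigma>_def using c S by simp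
  have section_large: "AE y in lebesgue. y \<in> cball q (2 * R) \<longrightarrow>
      (\<forall>x\<in>cball p R. \<forall>i. a (i + k) \<le> w x y \<longrightarrow> ennreal (\<sigma> i) \<le> g y)"
    using h(2)
  proof eventually_elim
    fix y assume y: "AE x in lebesgue. f (x, y) = h (x, y)"
    show "y \<in> cball q (2 * R) \<longrightarrow>
      (\<forall>x\<in>cball p R. \<forall>i. a (i + k) \<le> w x y \<longrightarrow> ennreal (\<sigma> i) \<le> g y)"
    proof (intro impI ballI allI)
      fix x i assume yq: "y \<in> cball q (2 * R)" and x: "x \<in> cball p R" and large: "a (i + k) \<le> w x y"
      have sub: "cball x R \<subseteq> cball p (2 * R)"
      proof
        fix x' assume "x' \<in> cball x R"
        then show "x' \<in> cball p (2 * R)" using x dist_triangle[of p x' x] by auto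
      qed
      \<comment> \<open>The scale is shifted by \<open>i\<close>, so that the value of \<open>w\<close> at \<open>x\<close> reaches its level \<open>k\<close>.\<close>
      have "ennreal (measure lebesgue (ball (0::'a) 1) / (2 * K * C) * (R / 4) ^ DIM('a))
           \<le> ennreal (real (k + 1) * S i ^ (DIM('a) - 1)) * (\<integral>\<^sup>+x. h (x, y) \<partial>lebesgue)"
      proof (rule domar_estimate[OF shifted_scale[of i] qns1[of y] R(1), where \<tau> = "\<lambda>l. \<tau> (l + i)"])
        show "cball x R \<subseteq> {x. (x, y) \<in> \<Omega>}" using sub R(2) yq by blast
        show "2 \<le> DIM('a)" using MN unfolding M_def by simp
        show "0 < \<tau> (l + i)" for l by (rule \<tau>)
        show "0 < S i" by (rule S)
        show "(\<Sum>l<n. \<tau> (l + i) powr (- 1 / (real DIM('a) - 1))) \<le> S i" for n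
          using S_sum[of i n] unfolding b_def M_def .
        show "(\<lambda>x. h (x, y)) \<in> borel_measurable lebesgue" by (rule h_section)
        show "a (k + i) \<le> pos_part (\<lambda>x. u (x, y)) x"
          unfolding w1 using large by (simp add: add.commute)
        show "AE x' in lebesgue. x' \<in> ball x R \<longrightarrow>
          (\<forall>l. a (l + i) \<le> pos_part (\<lambda>x. u (x, y)) x' \<longrightarrow> ennreal (\<tau> (l + i)) \<le> h (x', y))"
          using y
        proof eventually_elim
          fix x' assume eq: "f (x', y) = h (x', y)"
          show "x' \<in> ball x R \<longrightarrow>
            (\<forall>l. a (l + i) \<le> pos_part (\<lambda>x. u (x, y)) x' \<longrightarrow> ennreal (\<tau> (l + i)) \<le> h (x', y))"
            unfolding w1
          proof (intro impI allI)
            fix l assume x': "x' \<in> ball x R" and l: "a (l + i) \<le> w x' y"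
            have "(x', y) \<in> Q" using x' sub yq ball_subset_cball[of x R] unfolding Q_def by blast
            then have "h (x', y) = ennreal (\<psi> (w x' y))"
              using eq unfolding f_def w_def by simp
            moreover have "\<tau> (l + i) \<le> \<psi> (w x' y)"
              unfolding \<tau>_def using l scale_pos[of "l + i"] w_nonneg[of x' y]
              by (intro mono_onD[OF \<psi>(1)]) auto
            ultimately show "ennreal (\<tau> (l + i)) \<le> h (x', y)" by (simp add: ennreal_leI)
          qed
        qed
      qed
      then have "ennreal c \<le> ennreal (real (k + 1) * S i ^ (M - 1)) * g y"
        unfolding c_def M_def g_def .
      then show "ennreal (\<sigma> i) \<le> g y"
        unfolding \<sigma>_def using S[of i] by (intro ennreal_le_multD) auto
    qed
  qed

  \<comment> \<open>Up to a constant, \<open>\<sigma> i\<close> is \<open>S i powr (- (M - 1))\<close>. The sum that the second application needs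
    is therefore that of \<open>S i powr ((M - 1) / (N - 1))\<close>, which the Hardy-type inequality controls.\<close>
  define b' where "b' = (\<lambda>i. \<sigma> i powr (- 1 / (real N - 1)))"
  have b'_eq: "b' i = (c / real (k + 1)) powr (- 1 / (real N - 1)) * S i powr (1 / \<theta>)" for i
  proof -
    have "\<sigma> i = (c / real (k + 1)) * S i powr (- (real M - 1))"
    proof -
      have "real M - 1 = real (M - 1)" using MN by (simp add: of_nat_diff)
      then have "S i powr (- (real M - 1)) = 1 / S i ^ (M - 1)"
        using powr_realpow[OF S[of i], of "M - 1"] by (simp only: powr_minus inverse_eq_divide)
      then show ?thesis unfolding \<sigma>_def by simp
    qed
    moreover have "- x * (- 1 / y) = 1 / (y / x)" for x y :: real by simp
    then have "- (real M - 1) * (- 1 / (real N - 1)) = 1 / \<theta>" unfolding \<theta>_def .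
    ultimately show ?thesis
      unfolding b'_def using c S[of i] by (simp only: powr_mult powr_powr)
  qed
  have sb'': "summable b'" unfolding b'_eq[abs_def] by (intro summable_mult sS)
  have b'_pos: "b' i > 0" for i using \<sigma>[of i] unfolding b'_def by simp
  define c' where "c' = measure lebesgue (ball (0::'b) 1) / (2 * K * C) * (R / 4) ^ N"
  have c': "c' > 0" unfolding c'_def using K_ge_1 C_pos R by (simp add: content_ball_pos)
  \<comment> \<open>The tail sums \<open>T\<close> of \<open>b'\<close> tend to zero. One is chosen so small that the estimate in \<open>y\<close> becomes
    contradictory; the minimum with \<open>1\<close> gives \<open>T ^ (N - 1) \<le> T\<close>.\<close>
  define \<epsilon> where "\<epsilon> = min 1 (c' / (real (k + 1) * (H + 1)))"
  have "\<epsilon> > 0" unfolding \<epsilon>_def using c' H(2) by simp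
  then obtain j where "norm (\<Sum>i. b' (i + j)) < \<epsilon>"
    using suminf_exist_split[OF _ sb''] by blast
  moreover define T where "T = (\<Sum>i. b' (i + j))"
  ultimately have T_small: "T < \<epsilon>" by simp
  have T: "T > 0" unfolding T_def
    using b'_pos by (intro suminf_pos summable_ignore_initial_segment sb'') auto
  have T_sum: "(\<Sum>i<n. b' (i + j)) \<le> T" for n
    unfolding T_def using b'_pos less_imp_le
    by (intro sum_le_suminf summable_ignore_initial_segment sb'') auto
  have T_power: "real (k + 1) * T ^ (N - 1) * H < c'"
  proof -
    have "T ^ (N - 1) \<le> T ^ 1"
      using T T_small MN unfolding \<epsilon>_def by (intro power_decreasing) auto
    then have "real (k + 1) * T ^ (N - 1) * H \<le> real (k + 1) * T * (H + 1)"
      using H(2) T by (intro mult_mono) auto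
    also have "\<dots> = T * (real (k + 1) * (H + 1))" by simp
    also have "\<dots> < c'"
    proof -
      have "real (k + 1) * (H + 1) > 0" using H(2) by simp
      moreover have "T < c' / (real (k + 1) * (H + 1))" using T_small unfolding \<epsilon>_def by simp
      ultimately show ?thesis by (simp only: pos_less_divide_eq)
    qed
    finally show ?thesis .
  qed

  have "w x y \<le> a (k + (j + k))" if x: "x \<in> cball p R" and y: "y \<in> cball q R" for x y
  proof (rule ccontr)
    assume "\<not> ?thesis"
    then have large: "a (k + (j + k)) \<le> w x y" by simp
    have sub: "cball y R \<subseteq> cball q (2 * R)"
    proof
      fix y' assume "y' \<in> cball y R"
      then show "y' \<in> cball q (2 * R)" using y dist_triangle[of q y' y] by auto
    qed
    have xp: "x \<in> cball p (2 * R)" using x R(1) by auto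
    \<comment> \<open>The shift by \<open>j + k\<close> accounts for two losses: \<open>\<sigma> i\<close> is a lower bound for \<open>g\<close> only from level
      \<open>a (i + k)\<close> on, and only the tail of \<open>b'\<close> from \<open>j\<close> on is small.\<close>
    have "ennreal (measure lebesgue (ball (0::'b) 1) / (2 * K * C) * (R / 4) ^ DIM('b))
         \<le> ennreal (real (k + 1) * T ^ (DIM('b) - 1)) * (\<integral>\<^sup>+y. g y \<partial>lebesgue)"
    proof (rule domar_estimate[OF shifted_scale[of "j + k"] qns2[of x] R(1), where \<tau> = "\<lambda>l. \<sigma> (l + j)"])
      show "cball y R \<subseteq> {y. (x, y) \<in> \<Omega>}" using sub R(2) xp by blast
      show "2 \<le> DIM('b)" using MN unfolding N_def by simp
      show "0 < \<sigma> (l + j)" for l by (rule \<sigma>)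
      show "0 < T" by (rule T)
      show "(\<Sum>l<n. \<sigma> (l + j) powr (- 1 / (real DIM('b) - 1))) \<le> T" for n
        using T_sum[of n] unfolding b'_def N_def .
      show "g \<in> borel_measurable lebesgue" by (rule g_meas)
      show "a (k + (j + k)) \<le> pos_part (\<lambda>y. u (x, y)) y" unfolding w2 by (rule large)
      show "AE y' in lebesgue. y' \<in> ball y R \<longrightarrow>
          (\<forall>l. a (l + (j + k)) \<le> pos_part (\<lambda>y. u (x, y)) y' \<longrightarrow> ennreal (\<sigma> (l + j)) \<le> g y')"
        using section_large
      proof eventually_elim
        fix y' assume *: "y' \<in> cball q (2 * R) \<longrightarrow>
          (\<forall>x\<in>cball p R. \<forall>i. a (i + k) \<le> w x y' \<longrightarrow> ennreal (\<sigma> i) \<le> g y')"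
        show "y' \<in> ball y R \<longrightarrow>
          (\<forall>l. a (l + (j + k)) \<le> pos_part (\<lambda>y. u (x, y)) y' \<longrightarrow> ennreal (\<sigma> (l + j)) \<le> g y')"
          unfolding w2
        proof (intro impI allI)
          fix l assume "y' \<in> ball y R" and l: "a (l + (j + k)) \<le> w x y'"
          then have "y' \<in> cball q (2 * R)" using sub ball_subset_cball[of y R] by blast
          moreover have "a ((l + j) + k) \<le> w x y'" using l by (simp only: add.assoc)
          ultimately show "ennreal (\<sigma> (l + j)) \<le> g y'" using * x by blast
        qed
      qed
    qed
    also have "\<dots> = ennreal (real (k + 1) * T ^ (N - 1) * H)"
      unfolding g_int N_def using T H(2) by (intro ennreal_mult[symmetric]) auto
    finally have "c' \<le> real (k + 1) * T ^ (N - 1) * H"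
      unfolding c'_def N_def using T H(2) by (subst (asm) ennreal_le_iff) auto
    with T_power show False by simp
  qed
  then show ?thesis unfolding w_def by blast
qed

section \<open>The scale given by the two growth functions\<close>

text \<open>The inverses being defined forces \<open>\<phi>\<close> to be strictly increasing from \<open>s\<^sub>1 - s\<^sub>0\<close> on, and with it
  \<open>\<psi>\<inverse> \<circ> \<phi>\<close>. The scale starts at \<open>s\<^sub>1 + 1\<close>: there the ratio of consecutive values is bounded, and the
  values are positive, as \<open>s\<^sub>1 + 1\<close> lies strictly to the right of \<open>s\<^sub>1 - s\<^sub>0\<close>.\<close>

lemma growth_scale_from_inverse:
  fixes \<phi> \<psi> :: "real \<Rightarrow> real" and s\<^sub>0 s\<^sub>1 :: nat
  defines "F \<equiv> inv_nonneg \<psi> \<circ> \<phi>"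
  defines "T \<equiv> Inf {\<phi> (real s\<^sub>1 - real s\<^sub>0), \<psi> (real s\<^sub>1 - real s\<^sub>0)}"
  assumes K: "K \<ge> 1"
    and \<phi>: "mono_on {0..} \<phi>" "\<phi> ` {0..} \<subseteq> {0..}"
    and \<psi>: "mono_on {0..} \<psi>"
    and s: "s\<^sub>0 < s\<^sub>1"
    and inverse: "inverse_defined_on \<phi> {T..}" "inverse_defined_on \<psi> {T..}"
    and doubling: "\<And>s. s \<ge> real s\<^sub>1 \<Longrightarrow> 2 * K * F (s - real s\<^sub>0) \<le> F s"
    and ratio: "bounded ((\<lambda>s. F (s + 1) / F s) ` {real s\<^sub>1 + 1..})"
  obtains C where "growth_scale K C s\<^sub>0 (\<lambda>i. F (real (s\<^sub>1 + 1 + i)))"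
    and "\<And>i. \<psi> (F (real (s\<^sub>1 + 1 + i))) = \<phi> (real (s\<^sub>1 + 1 + i))"
    and "\<And>t. t > real s\<^sub>1 - real s\<^sub>0 \<Longrightarrow> \<phi> t > 0"
proof -
  define d where "d = real s\<^sub>1 - real s\<^sub>0"
  have d: "d \<ge> 0" using s unfolding d_def by simp
  have T: "T \<le> \<phi> d" unfolding T_def d_def by (intro cInf_lower) auto
  have \<phi>_ge: "\<phi> t \<in> {T..}" if "d \<le> t" for t
    using mono_onD[OF \<phi>(1), of d t] that d T by auto
  have \<phi>_less: "\<phi> r < \<phi> t" if "d \<le> r" "r < t" for r t
  proof -
    have "\<phi> r \<le> \<phi> t" using that d by (intro mono_onD[OF \<phi>(1)]) auto
    moreover have "\<phi> r \<noteq> \<phi> t"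
    proof
      assume eq: "\<phi> r = \<phi> t"
      have "\<exists>!s. s \<in> {0..} \<and> \<phi> s = \<phi> t"
        using inverse(1) \<phi>_ge[of t] that unfolding inverse_defined_on_def by auto
      moreover have "r \<in> {0..}" "t \<in> {0..}" using that d by auto
      ultimately have "r = t" using eq by blast
      with that show False by simp
    qed
    ultimately show ?thesis by simp
  qed
  have F: "F t \<ge> 0" "\<psi> (F t) = \<phi> t" if "d \<le> t" for t
  proof -
    have "\<exists>!s. s \<in> {0..} \<and> \<psi> s = \<phi> t"
      by (rule bspec[OF inverse(2)[unfolded inverse_defined_on_def] \<phi>_ge[OF that]])
    then obtain s where "s \<in> {0..}" "\<psi> s = \<phi> t" by (auto dest: ex1_implies_ex)
    then have "\<phi> t \<in> \<psi> ` {0..}" by (metis imageI)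
    then show "F t \<ge> 0" "\<psi> (F t) = \<phi> t"
      using inv_into_into[of "\<phi> t" \<psi> "{0..}"] f_inv_into_f[of "\<phi> t" \<psi> "{0..}"]
      unfolding F_def by auto
  qed
  have F_less: "F r < F t" if "d \<le> r" "r < t" for r t
  proof (rule ccontr)
    assume "\<not> ?thesis"
    then have "\<psi> (F t) \<le> \<psi> (F r)" using F(1)[of t] F(1)[of r] that by (intro mono_onD[OF \<psi>]) auto
    then show False using F(2)[of t] F(2)[of r] \<phi>_less[OF that] that by simp
  qed
  have d_less: "d < real (s\<^sub>1 + 1 + i)" for i unfolding d_def by simp
  have F_pos: "F (real (s\<^sub>1 + 1 + i)) > 0" for i
    using F_less[OF order_refl d_less[of i]] F(1)[of d] by simp
  obtain B where B: "\<And>s. s \<ge> real s\<^sub>1 + 1 \<Longrightarrow> \<bar>F (s + 1) / F s\<bar> \<le> B"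
    using ratio unfolding bounded_iff by auto
  show thesis
  proof
    show "growth_scale K (max B 1) s\<^sub>0 (\<lambda>i. F (real (s\<^sub>1 + 1 + i)))"
    proof
      show "mono (\<lambda>i. F (real (s\<^sub>1 + 1 + i)))"
      proof (rule monoI)
        fix i j :: nat assume "i \<le> j"
        then show "F (real (s\<^sub>1 + 1 + i)) \<le> F (real (s\<^sub>1 + 1 + j))"
          using F_less[of "real (s\<^sub>1 + 1 + i)" "real (s\<^sub>1 + 1 + j)"] d_less[of i]
          by (cases "i = j") auto
      qed
      show "2 * K * F (real (s\<^sub>1 + 1 + i)) \<le> F (real (s\<^sub>1 + 1 + (i + s\<^sub>0)))" for i
        using doubling[of "real (s\<^sub>1 + 1 + (i + s\<^sub>0))"] by (simp add: algebra_simps)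
      show "F (real (s\<^sub>1 + 1 + Suc i)) \<le> max B 1 * F (real (s\<^sub>1 + 1 + i))" for i
      proof -
        define r where "r = real (s\<^sub>1 + 1 + i)"
        have "F (r + 1) / F r \<le> B" unfolding r_def by (rule abs_le_D1[OF B]) simp
        then have "F (r + 1) / F r \<le> max B 1" by simp
        then have "F (r + 1) \<le> max B 1 * F r"
          using F_pos[of i] unfolding r_def by (simp only: pos_divide_le_eq)
        moreover have "real (s\<^sub>1 + 1 + Suc i) = r + 1" unfolding r_def by simp
        ultimately show ?thesis unfolding r_def by simp
      qed
    qed (use K F_pos in auto)
    show "\<psi> (F (real (s\<^sub>1 + 1 + i))) = \<phi> (real (s\<^sub>1 + 1 + i))" for i
      using F(2) d_less[of i] by simp
    show "\<phi> t > 0" if "t > real s\<^sub>1 - real s\<^sub>0" for t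
      using \<phi>_less[OF order_refl that[folded d_def]] \<phi>(2) d by fastforce
  qed
qed

text \<open>The integral test, with the numerator estimated at the left and the denominator at the right end of
  each unit interval. The shift of \<open>\<phi>\<close> by \<open>s\<^sub>0\<close> disappears when the first \<open>s\<^sub>0\<close> terms are dropped,
  since that only increases the base of the numerator.\<close>

lemma summable_from_integral:
  fixes \<phi> :: "real \<Rightarrow> real" and s\<^sub>0 s\<^sub>1 :: nat
  assumes \<phi>: "mono_on {0..} \<phi>" and s: "s\<^sub>0 < s\<^sub>1" and exponents: "\<theta> \<ge> 0" "\<kappa> \<ge> 0"
    and pos: "\<And>t. t > real s\<^sub>1 - real s\<^sub>0 \<Longrightarrow> \<phi> t > 0"
    and integral: "(\<integral>\<^sup>+s\<in>{real s\<^sub>1..}. ennreal (s powr \<theta> / \<phi> (s - real s\<^sub>0) powr \<kappa>) \<partial>lborel) < \<infinity>"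
  shows "summable (\<lambda>i. real (Suc i) powr \<theta> * \<phi> (real (s\<^sub>1 + 1 + i)) powr (- \<kappa>))"
proof -
  define c where "c = (\<lambda>i. real (s\<^sub>1 + i) powr \<theta> * \<phi> (real (s\<^sub>1 + i + 1) - real s\<^sub>0) powr (- \<kappa>))"
  define I where "I = (\<lambda>i. {real (s\<^sub>1 + i)<..<real (s\<^sub>1 + i + 1)})"
  obtain B where B: "B \<ge> 0"
    "(\<integral>\<^sup>+s\<in>{real s\<^sub>1..}. ennreal (s powr \<theta> / \<phi> (s - real s\<^sub>0) powr \<kappa>) \<partial>lborel) = ennreal B"
    using integral by (cases "\<integral>\<^sup>+s\<in>{real s\<^sub>1..}. ennreal (s powr \<theta> / \<phi> (s - real s\<^sub>0) powr \<kappa>) \<partial>lborel") auto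
  have c_nonneg: "c i \<ge> 0" for i unfolding c_def by simp
  have partial_sum: "(\<Sum>i\<in>A. c i) \<le> B" if "finite A" for A
  proof -
    have "ennreal (\<Sum>i\<in>A. c i) = (\<Sum>i\<in>A. ennreal (c i) * emeasure lborel (I i))"
      using c_nonneg by (simp add: I_def sum_ennreal)
    also have "\<dots> = (\<integral>\<^sup>+s. (\<Sum>i\<in>A. ennreal (c i) * indicator (I i) s) \<partial>lborel)"
      by (subst nn_integral_sum) (auto simp: nn_integral_cmult_indicator I_def)
    also have "\<dots> \<le> (\<integral>\<^sup>+s\<in>{real s\<^sub>1..}. ennreal (s powr \<theta> / \<phi> (s - real s\<^sub>0) powr \<kappa>) \<partial>lborel)"
    proof (rule nn_integral_mono)
      fix t
      show "(\<Sum>i\<in>A. ennreal (c i) * indicator (I i) t)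
         \<le> ennreal (t powr \<theta> / \<phi> (t - real s\<^sub>0) powr \<kappa>) * indicator {real s\<^sub>1..} t"
      proof (cases "\<exists>j\<in>A. t \<in> I j")
        case True
        then obtain j where j: "j \<in> A" "t \<in> I j" by blast
        have "(\<Sum>i\<in>A. ennreal (c i) * indicator (I i) t) = (\<Sum>i\<in>A. if i = j then ennreal (c j) else 0)"
          using j unfolding I_def by (intro sum.cong) (auto simp: indicator_def)
        also have "\<dots> = ennreal (c j)" using that j by simp
        also have "\<dots> \<le> ennreal (t powr \<theta> / \<phi> (t - real s\<^sub>0) powr \<kappa>)"
        proof (rule ennreal_leI)
          have t: "real (s\<^sub>1 + j) < t" "t < real (s\<^sub>1 + j + 1)" using j(2) unfolding I_def by auto
          have "\<phi> (t - real s\<^sub>0) > 0" using t by (intro pos) simp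
          moreover have "\<phi> (t - real s\<^sub>0) \<le> \<phi> (real (s\<^sub>1 + j + 1) - real s\<^sub>0)"
            using t s by (intro mono_onD[OF \<phi>]) auto
          ultimately have "\<phi> (real (s\<^sub>1 + j + 1) - real s\<^sub>0) powr (- \<kappa>) \<le> \<phi> (t - real s\<^sub>0) powr (- \<kappa>)"
            using exponents by (intro powr_mono2') auto
          moreover have "real (s\<^sub>1 + j) powr \<theta> \<le> t powr \<theta>"
            using t exponents by (intro powr_mono2) auto
          ultimately show "c j \<le> t powr \<theta> / \<phi> (t - real s\<^sub>0) powr \<kappa>"
            unfolding c_def divide_inverse powr_minus[symmetric] by (intro mult_mono) auto
        qed
        also have "\<dots> = \<dots> * indicator {real s\<^sub>1..} t" using j unfolding I_def by simp
        finally show ?thesis .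
      next
        case False
        then have "(\<Sum>i\<in>A. ennreal (c i) * indicator (I i) t) = 0" by (intro sum.neutral) auto
        then show ?thesis by simp
      qed
    qed
    finally show ?thesis unfolding B(2) using B(1) by (simp add: ennreal_le_iff)
  qed
  have "summable c"
    by (rule bounded_imp_summable[of c B]) (auto simp: c_nonneg intro: partial_sum)
  then have "summable (\<lambda>i. c (i + s\<^sub>0))" by (rule summable_ignore_initial_segment)
  then show ?thesis
  proof (rule summable_comparison_test')
    fix i
    have "real (Suc i) powr \<theta> \<le> real (s\<^sub>1 + (i + s\<^sub>0)) powr \<theta>"
      using s exponents by (intro powr_mono2) auto
    then have "real (Suc i) powr \<theta> * \<phi> (real (s\<^sub>1 + 1 + i)) powr (- \<kappa>)
       \<le> real (s\<^sub>1 + (i + s\<^sub>0)) powr \<theta> * \<phi> (real (s\<^sub>1 + 1 + i)) powr (- \<kappa>)"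
      by (intro mult_right_mono) auto
    also have "\<dots> = c (i + s\<^sub>0)" unfolding c_def by (simp add: algebra_simps)
    finally show "norm (real (Suc i) powr \<theta> * \<phi> (real (s\<^sub>1 + 1 + i)) powr (- \<kappa>)) \<le> c (i + s\<^sub>0)" by simp
  qed
qed

section \<open>From the sections to the product space\<close>

lemma locally_bounded_imp_locally_integrable:
  fixes f :: "'a::euclidean_space \<Rightarrow> real"
  assumes meas: "f \<in> borel_measurable (lebesgue_on D)"
    and nonneg: "\<And>z. f z \<ge> 0"
    and bounded: "\<And>z. z \<in> D \<Longrightarrow> \<exists>U B. open U \<and> z \<in> U \<and> (\<forall>x\<in>U. f x \<le> B)"
  shows "f locally_integrable_on D"
  unfolding locally_integrable_on_def
proof (intro allI impI)
  fix A assume A: "compact A" "A \<subseteq> D"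
  obtain U B where UB: "\<And>z. z \<in> A \<Longrightarrow> open (U z) \<and> z \<in> U z \<and> (\<forall>x\<in>U z. f x \<le> B z)"
    using bounded A(2) by (metis subsetD)
  obtain Z where Z: "Z \<subseteq> A" "finite Z" "A \<subseteq> (\<Union>z\<in>Z. U z)"
    using compactE_image[OF A(1), of A U] UB by blast
  have bound: "f x \<le> (\<Sum>z\<in>Z. max (B z) 0)" if x: "x \<in> A" for x
  proof -
    obtain z where z: "z \<in> Z" "x \<in> U z" using Z(3) x by blast
    have "f x \<le> B z" using UB[of z] z Z(1) by blast
    also have "\<dots> \<le> (\<Sum>z\<in>{z}. max (B z) 0)" by simp
    also have "\<dots> \<le> (\<Sum>z\<in>Z. max (B z) 0)" using z Z(2) by (intro sum_mono2) auto
    finally show ?thesis .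
  qed
  show "f absolutely_integrable_on A"
  proof (rule measurable_bounded_by_integrable_imp_absolutely_integrable)
    show "f \<in> borel_measurable (lebesgue_on A)" using measurable_restrict_mono[OF meas A(2)] .
    show "A \<in> sets lebesgue" using A(1) lmeasurable_compact by blast
    show "(\<lambda>_. \<Sum>z\<in>Z. max (B z) 0) integrable_on A"
      using A(1) by (intro integrable_on_const lmeasurable_compact)
    show "norm (f x) \<le> (\<Sum>z\<in>Z. max (B z) 0)" if "x \<in> A" for x using bound[OF that] nonneg[of x] by simp
  qed
qed

text \<open>Two balls of radius \<open>r / 2\<close> have their product inside the ball of radius \<open>r\<close>. Applying the mean value
  inequality in \<open>x\<close> over the first and then in \<open>y\<close> over the second bounds the value at the centre
  by an integral over this product. Local integrability in both variables together is what allows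
  passing from there to the Bochner integral over the whole ball. The constant \<open>L\<close> compares the volume
  of the ball with that of the product.\<close>

lemma separately_qns_imp_qns:
  fixes u :: "'a::euclidean_space \<times> 'b::euclidean_space \<Rightarrow> ereal"
  assumes \<Omega>: "open \<Omega>"
    and meas: "u \<in> borel_measurable (lebesgue_on \<Omega>)" and finite: "\<And>z. z \<in> \<Omega> \<Longrightarrow> u z < \<infinity>"
    and qns1: "\<And>y. K_quasi_nearly_subharmonic K {x. (x, y) \<in> \<Omega>} (\<lambda>x. u (x, y))"
    and qns2: "\<And>x. K_quasi_nearly_subharmonic K {y. (x, y) \<in> \<Omega>} (\<lambda>y. u (x, y))"
    and loc_int: "pos_part u locally_integrable_on \<Omega>"
  shows "quasi_nearly_subharmonic \<Omega> u"
proof -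
  have K: "K \<ge> 1" using qns1[of undefined] unfolding K_quasi_nearly_subharmonic_def by blast
  define V\<^sub>1 where "V\<^sub>1 = measure lebesgue (ball (0::'a) 1)"
  define V\<^sub>2 where "V\<^sub>2 = measure lebesgue (ball (0::'b) 1)"
  define V where "V = measure lebesgue (ball (0::'a \<times> 'b) 1)"
  have V: "V\<^sub>1 > 0" "V\<^sub>2 > 0" "V > 0" unfolding V\<^sub>1_def V\<^sub>2_def V_def by (simp_all add: content_ball_pos)
  define L where "L = K * K * V * 2 ^ (DIM('a) + DIM('b)) / (V\<^sub>1 * V\<^sub>2)"
  have mean_value: "trunc_below M u z \<le> L / (V * r ^ DIM('a \<times> 'b)) * (LINT y:ball z r|lebesgue. trunc_below M u y)"
    if r: "r > 0" and sub: "cball z r \<subseteq> \<Omega>" and M: "M \<ge> 0" for z r M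
  proof -
    obtain p q where z: "z = (p, q)" by (cases z)
    define t where "t = (\<lambda>z. trunc_below M u z)"
    have t: "t z \<ge> 0" for z unfolding t_def by (rule trunc_below_nonneg)
    have t1: "trunc_below M (\<lambda>x. u (x, y)) x = t (x, y)" and t2: "trunc_below M (\<lambda>y. u (x, y)) y = t (x, y)"
      for x y unfolding t_def trunc_below_def by simp_all
    define P where "P = ball p (r / 2) \<times> ball q (r / 2)"
    have prod_sub: "cball p (r / 2) \<times> cball q (r / 2) \<subseteq> ball z r"
    proof
      fix z' assume "z' \<in> cball p (r / 2) \<times> cball q (r / 2)"
      then obtain x y where z': "z' = (x, y)" "dist p x \<le> r / 2" "dist q y \<le> r / 2" by auto
      have "(dist p x)\<^sup>2 \<le> (r / 2)\<^sup>2" "(dist q y)\<^sup>2 \<le> (r / 2)\<^sup>2"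
        using z' by (auto intro: power_mono)
      then have "(dist p x)\<^sup>2 + (dist q y)\<^sup>2 \<le> r\<^sup>2 / 2" by (simp add: power_divide)
      also have "\<dots> < r\<^sup>2" using r by simp
      finally have "sqrt ((dist p x)\<^sup>2 + (dist q y)\<^sup>2) < r" using r by (intro real_less_lsqrt) auto
      then show "z' \<in> ball z r" unfolding z z' by (simp add: dist_Pair_Pair)
    qed
    then have prod_\<Omega>: "cball p (r / 2) \<times> cball q (r / 2) \<subseteq> \<Omega>"
      using sub ball_subset_cball[of z r] by blast
    have P_sub: "P \<subseteq> ball z r"
      using prod_sub ball_subset_cball[of p "r / 2"] ball_subset_cball[of q "r / 2"]
      unfolding P_def by blast

    have t_int: "integrable lebesgue (\<lambda>y. indicator (ball z r) y * t y)"
    proof -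
      have "pos_part u absolutely_integrable_on cball z r"
        using loc_int sub unfolding locally_integrable_on_def by auto
      moreover have "(\<lambda>_. M) absolutely_integrable_on cball z r"
        by (intro absolutely_integrable_on_const lmeasurable_cball)
      ultimately have "(\<lambda>y. pos_part u y + M) absolutely_integrable_on cball z r"
        by (rule set_integral_add)
      then have "(\<lambda>y. pos_part u y + M) absolutely_integrable_on ball z r"
        by (rule set_integrable_subset) (auto simp: ball_subset_cball)
      then have "t absolutely_integrable_on ball z r"
      proof (rule set_integrable_bound)
        have "t \<in> borel_measurable (lebesgue_on (ball z r))"
          unfolding t_def using sub ball_subset_cball[of z r]
          by (intro measurable_restrict_mono[OF borel_measurable_trunc_below[OF meas]]) blast
        then show "set_borel_measurable lebesgue (ball z r) t"
          unfolding set_borel_measurable_def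
          by (subst borel_measurable_restrict_space_iff[symmetric]) auto
        show "AE y\<in>ball z r in lebesgue. norm (t y) \<le> norm (pos_part u y + M)"
        proof (intro AE_I2 impI)
          fix y assume "y \<in> ball z r"
          then have "u y < \<infinity>" using sub ball_subset_cball[of z r] finite by blast
          then show "norm (t y) \<le> norm (pos_part u y + M)"
            using trunc_below_le[of u y M] M t[of y] pos_part_nonneg[of u y] unfolding t_def by simp
        qed
      qed
      then show ?thesis unfolding set_integrable_def by simp
    qed
    define f where "f = (\<lambda>y. ennreal (indicator P y * t y))"
    have f_meas: "f \<in> borel_measurable lebesgue"
    proof -
      have "(\<lambda>y. indicator P y * (indicator (ball z r) y * t y)) \<in> borel_measurable lebesgue"
      proof (rule borel_measurable_times[OF borel_measurable_indicator borel_measurable_integrable[OF t_int]])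
        show "P \<in> sets lebesgue" unfolding P_def by (simp add: borel_open open_Times)
      qed
      moreover have "indicator P y * (indicator (ball z r) y * t y) = indicator P y * t y" for y
        using P_sub by (auto simp: indicator_def)
      ultimately show ?thesis unfolding f_def by simp
    qed
    obtain h where h: "h \<in> borel_measurable borel"
      "AE x in lebesgue. AE y in lebesgue. f (x, y) = h (x, y)"
      "(\<integral>\<^sup>+z. f z \<partial>lebesgue) = (\<integral>\<^sup>+x. (\<integral>\<^sup>+y. h (x, y) \<partial>lebesgue) \<partial>lebesgue)"
      using lebesgue_Tonelli[OF f_meas] by blast

    define c\<^sub>1 where "c\<^sub>1 = K / (V\<^sub>1 * (r / 2) ^ DIM('a))"
    define c\<^sub>2 where "c\<^sub>2 = K / (V\<^sub>2 * (r / 2) ^ DIM('b))"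
    have c: "c\<^sub>1 \<ge> 0" "c\<^sub>2 \<ge> 0" unfolding c\<^sub>1_def c\<^sub>2_def using K V r by simp_all
    have "ennreal (t (p, q)) \<le> ennreal c\<^sub>1 * (\<integral>\<^sup>+x. ennreal (indicator (ball p (r / 2)) x * t (x, q)) \<partial>lebesgue)"
    proof -
      have "q \<in> cball q (r / 2)" using r by simp
      then have "cball p (r / 2) \<subseteq> {x. (x, q) \<in> \<Omega>}" using prod_\<Omega> by blast
      then show ?thesis
        using qns_mean_value[OF qns1[of q], of "r / 2" p M] r M
        unfolding c\<^sub>1_def V\<^sub>1_def t1 by simp
    qed
    also have "\<dots> \<le> ennreal c\<^sub>1 * (\<integral>\<^sup>+x. ennreal c\<^sub>2 * (\<integral>\<^sup>+y. f (x, y) \<partial>lebesgue) \<partial>lebesgue)"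
    proof (intro mult_left_mono nn_integral_mono)
      fix x
      show "ennreal (indicator (ball p (r / 2)) x * t (x, q)) \<le> ennreal c\<^sub>2 * (\<integral>\<^sup>+y. f (x, y) \<partial>lebesgue)"
      proof (cases "x \<in> ball p (r / 2)")
        case True
        then have "x \<in> cball p (r / 2)" by simp
        then have "cball q (r / 2) \<subseteq> {y. (x, y) \<in> \<Omega>}" using prod_\<Omega> by blast
        then have "ennreal (t (x, q)) \<le> ennreal c\<^sub>2 * (\<integral>\<^sup>+y. ennreal (indicator (ball q (r / 2)) y * t (x, y)) \<partial>lebesgue)"
          using qns_mean_value[OF qns2[of x], of "r / 2" q M] r M
          unfolding c\<^sub>2_def V\<^sub>2_def t2 by simp
        then show ?thesis using True unfolding f_def P_def by (simp add: indicator_times)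
      qed simp
    qed simp
    also have "\<dots> = ennreal (c\<^sub>1 * c\<^sub>2) * (\<integral>\<^sup>+z. f z \<partial>lebesgue)"
    proof -
      have "(\<integral>\<^sup>+x. ennreal c\<^sub>2 * (\<integral>\<^sup>+y. f (x, y) \<partial>lebesgue) \<partial>lebesgue)
          = (\<integral>\<^sup>+x. ennreal c\<^sub>2 * (\<integral>\<^sup>+y. h (x, y) \<partial>lebesgue) \<partial>lebesgue)"
        by (intro nn_integral_cong_AE)
          (use h(2) in eventually_elim, intro arg_cong2[of _ _ _ _ "(*)"] refl nn_integral_cong_AE)
      also have "\<dots> = ennreal c\<^sub>2 * (\<integral>\<^sup>+x. (\<integral>\<^sup>+y. h (x, y) \<partial>lebesgue) \<partial>lebesgue)"
      proof (rule nn_integral_cmult)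
        have "h \<in> borel_measurable (lborel \<Otimes>\<^sub>M lborel)" using h(1) unfolding lborel_prod by simp
        then have "(\<lambda>x. \<integral>\<^sup>+y. h (x, y) \<partial>lborel) \<in> borel_measurable lborel"
          by (rule lborel.borel_measurable_nn_integral_fst)
        then show "(\<lambda>x. \<integral>\<^sup>+y. h (x, y) \<partial>lebesgue) \<in> borel_measurable lebesgue"
          unfolding nn_integral_completion by (rule measurable_completion)
      qed
      finally show ?thesis unfolding h(3) using c by (simp add: ennreal_mult mult.assoc)
    qed
    also have "\<dots> \<le> ennreal (c\<^sub>1 * c\<^sub>2) * (\<integral>\<^sup>+y. ennreal (indicator (ball z r) y * t y) \<partial>lebesgue)"
      unfolding f_def using t P_sub
      by (intro mult_left_mono nn_integral_mono ennreal_leI mult_right_mono) (auto simp: indicator_def)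
    also have "\<dots> = ennreal (c\<^sub>1 * c\<^sub>2) * ennreal (LINT y:ball z r|lebesgue. t y)"
      using t nn_integral_eq_integral[OF t_int] by (simp add: set_lebesgue_integral_def)
    also have "\<dots> = ennreal (c\<^sub>1 * c\<^sub>2 * (LINT y:ball z r|lebesgue. t y))"
      using c by (intro ennreal_mult'[symmetric]) simp
    finally have "t z \<le> c\<^sub>1 * c\<^sub>2 * (LINT y:ball z r|lebesgue. t y)"
    proof (subst (asm) ennreal_le_iff)
      have "(LINT y:ball z r|lebesgue. t y) \<ge> 0"
        unfolding set_lebesgue_integral_def using t by (intro integral_nonneg_AE AE_I2) simp
      then show "c\<^sub>1 * c\<^sub>2 * (LINT y:ball z r|lebesgue. t y) \<ge> 0" using c by simp
    qed (simp add: z)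
    also have "c\<^sub>1 * c\<^sub>2 = L / (V * r ^ DIM('a \<times> 'b))"
      unfolding c\<^sub>1_def c\<^sub>2_def L_def using V r by (simp add: power_add power_divide field_simps)
    finally show ?thesis unfolding t_def .
  qed
  \<comment> \<open>The maximum with \<open>1\<close> is taken only because a constant of quasi-near subharmonicity is at least
    \<open>1\<close> by definition.\<close>
  have "K_quasi_nearly_subharmonic (max L 1) \<Omega> u"
    unfolding K_quasi_nearly_subharmonic_def
  proof (intro conjI allI impI)
    fix z r M assume *: "0 < (r::real)" "cball z r \<subseteq> \<Omega>" "0 \<le> (M::real)"
    have "(LINT y:ball z r|lebesgue. trunc_below M u y) \<ge> 0"
      unfolding set_lebesgue_integral_def
      by (intro integral_nonneg_AE AE_I2) (simp add: trunc_below_nonneg)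
    then have "L / (V * r ^ DIM('a \<times> 'b)) * (LINT y:ball z r|lebesgue. trunc_below M u y)
       \<le> max L 1 / (V * r ^ DIM('a \<times> 'b)) * (LINT y:ball z r|lebesgue. trunc_below M u y)"
      using V *(1) by (intro mult_right_mono divide_right_mono) auto
    with mean_value[OF *]
    show "trunc_below M u z \<le> max L 1 / (measure lebesgue (ball (0::'a \<times> 'b) 1) * r ^ DIM('a \<times> 'b))
             * (LINT y:ball z r|lebesgue. trunc_below M u y)"
      unfolding V_def by linarith
  qed (use meas finite loc_int in auto)
  then show ?thesis unfolding quasi_nearly_subharmonic_def by (intro exI[of _ "max L 1"]) simp
qed

section \<open>Separately quasi-nearly subharmonic functions\<close>

theorem theorem4p2:
  fixes \<Omega> :: "((real ^ 'm) \<times> (real ^ 'n)) set"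
    and u :: "(real ^ 'm) \<times> (real ^ 'n) \<Rightarrow> ereal"
    and K :: real
    and \<phi> \<psi> :: "real \<Rightarrow> real"
    and s\<^sub>0 s\<^sub>1 :: nat
  assumes dims: "CARD('m) \<ge> CARD('n)" "CARD('n) \<ge> 2"
    and domain: "open \<Omega>" "connected \<Omega>" "\<Omega> \<noteq> {}"
    and K: "K \<ge> 1"
    and u_meas: "u \<in> borel_measurable (lebesgue_on \<Omega>)"
    and u_less_infinity: "\<And>z. z \<in> \<Omega> \<Longrightarrow> u z < \<infinity>"
    and a: "\<And>y. K_quasi_nearly_subharmonic K {x. (x, y) \<in> \<Omega>} (\<lambda>x. u (x, y))"
    and b: "\<And>x. K_quasi_nearly_subharmonic K {y. (x, y) \<in> \<Omega>} (\<lambda>y. u (x, y))"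
    and \<phi>: "mono_on {0..} \<phi>" "\<phi> ` {0..} \<subseteq> {0..}"
    and \<psi>: "mono_on {0..} \<psi>" "\<psi> ` {0..} \<subseteq> {0..}"
    and s\<^sub>0_less_s\<^sub>1: "s\<^sub>0 < s\<^sub>1"
    and c1: "inverse_defined_on \<phi> {Inf {\<phi> (real s\<^sub>1 - real s\<^sub>0), \<psi> (real s\<^sub>1 - real s\<^sub>0)}..}"
            "inverse_defined_on \<psi> {Inf {\<phi> (real s\<^sub>1 - real s\<^sub>0), \<psi> (real s\<^sub>1 - real s\<^sub>0)}..}"
    and c2: "\<And>s. s \<ge> real s\<^sub>1 \<Longrightarrow>
               2 * K * (inv_nonneg \<psi> \<circ> \<phi>) (s - real s\<^sub>0) \<le> (inv_nonneg \<psi> \<circ> \<phi>) s"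
    and c3: "bounded ((\<lambda>s. (inv_nonneg \<psi> \<circ> \<phi>) (s + 1) / (inv_nonneg \<psi> \<circ> \<phi>) s) ` {real s\<^sub>1 + 1..})"
    and c4: "(\<integral>\<^sup>+s\<in>{real s\<^sub>1..}.
                ennreal (s powr ((real CARD('n) - 1) / (real CARD('m) - 1)) /
                         \<phi> (s - real s\<^sub>0) powr (1 / (real CARD('m) - 1))) \<partial>lborel) < \<infinity>"
    and c5: "(\<psi> \<circ> pos_part u) locally_integrable_on \<Omega>"
  shows "quasi_nearly_subharmonic \<Omega> u"
proof (rule separately_qns_imp_qns[OF domain(1) u_meas u_less_infinity a b])
  define \<alpha> where "\<alpha> = (\<lambda>i. (inv_nonneg \<psi> \<circ> \<phi>) (real (s\<^sub>1 + 1 + i)))"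
  obtain C where scale: "growth_scale K C s\<^sub>0 \<alpha>"
    and \<psi>_\<alpha>: "\<And>i. \<psi> (\<alpha> i) = \<phi> (real (s\<^sub>1 + 1 + i))"
    and \<phi>_pos: "\<And>t. t > real s\<^sub>1 - real s\<^sub>0 \<Longrightarrow> \<phi> t > 0"
    using growth_scale_from_inverse[OF K \<phi> \<psi>(1) s\<^sub>0_less_s\<^sub>1 c1 c2 c3] unfolding \<alpha>_def by metis
  have \<alpha>_pos: "\<psi> (\<alpha> i) > 0" for i unfolding \<psi>_\<alpha> by (intro \<phi>_pos) simp
  have "summable (\<lambda>i. real (Suc i) powr ((real CARD('n) - 1) / (real CARD('m) - 1))
        * \<phi> (real (s\<^sub>1 + 1 + i)) powr (- (1 / (real CARD('m) - 1))))"
    using dims by (intro summable_from_integral[OF \<phi>(1) s\<^sub>0_less_s\<^sub>1 _ _ \<phi>_pos c4]) auto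
  then have weights: "summable (\<lambda>i. real (Suc i) powr ((real DIM(real ^ 'n) - 1) / (real DIM(real ^ 'm) - 1))
        * \<psi> (\<alpha> i) powr (- 1 / (real DIM(real ^ 'm) - 1)))"
    unfolding \<psi>_\<alpha> by simp
  show "pos_part u locally_integrable_on \<Omega>"
  proof (rule locally_bounded_imp_locally_integrable)
    show "pos_part u \<in> borel_measurable (lebesgue_on \<Omega>)" by (rule borel_measurable_pos_part[OF u_meas])
    show "0 \<le> pos_part u z" for z by (rule pos_part_nonneg)
    fix z assume z: "z \<in> \<Omega>"
    obtain p q where pq: "z = (p, q)" by (cases z)
    obtain A B where AB: "open A" "open B" "z \<in> A \<times> B" "A \<times> B \<subseteq> \<Omega>"
      using open_prod_elim[OF domain(1) z] by blast
    have "p \<in> A" "q \<in> B" using AB(3) pq by auto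
    obtain r\<^sub>1 where r1: "r\<^sub>1 > 0" "cball p r\<^sub>1 \<subseteq> A"
      using open_contains_cball[of A] AB(1) \<open>p \<in> A\<close> by blast
    obtain r\<^sub>2 where r2: "r\<^sub>2 > 0" "cball q r\<^sub>2 \<subseteq> B"
      using open_contains_cball[of B] AB(2) \<open>q \<in> B\<close> by blast
    define R where "R = min r\<^sub>1 r\<^sub>2 / 2"
    have R: "R > 0" "2 * R \<le> r\<^sub>1" "2 * R \<le> r\<^sub>2" unfolding R_def using r1 r2 by auto
    have sub: "cball p (2 * R) \<times> cball q (2 * R) \<subseteq> \<Omega>"
      using subset_cball[OF R(2), of p] subset_cball[OF R(3), of q] r1 r2 AB(4) by blast
    have "(\<psi> \<circ> pos_part u) absolutely_integrable_on cball p (2 * R) \<times> cball q (2 * R)"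
      using c5 sub unfolding locally_integrable_on_def by (simp add: compact_Times)
    moreover have "2 \<le> DIM(real ^ 'n)" "DIM(real ^ 'n) \<le> DIM(real ^ 'm)" using dims by simp_all
    moreover have "\<psi> t \<ge> 0" if "t \<ge> 0" for t using \<psi>(2) that by auto
    ultimately have "\<exists>B. \<forall>x\<in>cball p R. \<forall>y\<in>cball q R. pos_part u (x, y) \<le> B"
      using separately_qns_bounded_on_product[OF scale _ _ R(1) sub a b \<psi>(1) \<alpha>_pos _ _ weights] by blast
    then obtain B' where "\<forall>x\<in>cball p R. \<forall>y\<in>cball q R. pos_part u (x, y) \<le> B'" by blast
    then show "\<exists>U B. open U \<and> z \<in> U \<and> (\<forall>x\<in>U. pos_part u x \<le> B)"
      using R(1) pq ball_subset_cball[of p R] ball_subset_cball[of q R]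
      by (intro exI[of _ "ball p R \<times> ball q R"] exI[of _ B']) (auto simp: open_Times)
  qed
qed

end
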